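(* Let $n\ge 3$. The order complex $\Delta(\Pi_n)$ of the partition lattice can be obtained from the complex of trees $T_n$ by a sequence of stellar subdivisions.
   Context: **Trees.** A tree is a cycle-free (connected) graph; vertices of degree $1$ are its leaves. A rooted tree has one vertex of degree $>1$ marked as root. Internal vertices are the vertices other than the leaves and the root; they are assumed to have degree at least $3$. Equivalently, all non-leaves have outdegree at least $2$, where the outdegree of a vertex is the number of adjacent edges not lying on the path between the vertex and the root. A rooted tree is binary if all non-leaves have outdegree exactly $2$. An internal edge is an edge not adjacent to a leaf; a rooted binary tree on $n$ leaves has exactly $n-2$ internal edges. The combinatorial type of a rooted tree with labelled leaves is its equivalence class under label- and root-preserving homeomorphisms of trees as $1$-dimensional cell complexes. **Complex of trees.** For $n\ge 3$, $T_n$ is the abstract simplicial complex whose maximal simplices are the combinatorial types of binary rooted trees with $n$ leaves labelled $1,\dots,n$, and whose lower dimensional simplices are obtained by contracting at most $n-3$ internal edges. Thus vertices are the types of rooted trees with leaves labelled $1,\dots,n$ having exactly one internal edge, and a tree with $m\ge1$ internal edges is the $(m-1)$-simplex whose vertices are the $m$ trees obtained from it by contracting all but one of its internal edges; faces correspond to contracting internal edges. (The tree without internal edges corresponds to the empty simplex.) **Partition lattice and order complex.** $\Pi_n$ is the lattice of set partitions of $[n]=\{1,\dots,n\}$, ordered by reversed refinement, so that $\hat 0$ is the partition into singletons and $\hat 1$ is the partition with one block. $\Delta(\Pi_n)$ denotes the order complex of the proper part $\Pi_n\setminus\{\hat 0,\hat 1\}$, i.e. the abstract simplicial complex of its chains.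 **Stellar subdivision.** For an abstract simplicial complex $K$ and a nonempty simplex $F\in K$, the stellar subdivision $\mathrm{st}(K,F)$ has one new vertex $v$; its simplices are the simplices of $K$ not containing $F$, together with all $\{v\}\cup\tau$ where $\tau\in K$, $\tau\not\supseteq F$ and $\tau\cup F\in K$. Abstract simplicial complexes are considered up to isomorphism. *)

theory Defs
  imports Main "HOL-Library.Disjoint_Sets"
begin

section \<open>Abstract simplicial complexes\<close>

text \<open>A complex is its set of simplices, always including the empty simplex; its vertex set is
  \<open>\<Union>K\<close>.\<close>

definition complex_iso :: "'a set set \<Rightarrow> 'b set set \<Rightarrow> bool" where
  "complex_iso K L \<longleftrightarrow> (\<exists>f. inj_on f (\<Union>K) \<and> (`) f ` K = L)"

definition stellar_subdivision :: "'a set set \<Rightarrow> 'a set \<Rightarrow> 'a \<Rightarrow> 'a set set" where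
  "stellar_subdivision K F v =
     {\<sigma> \<in> K. \<not> F \<subseteq> \<sigma>} \<union> {insert v \<tau> | \<tau>. \<tau> \<in> K \<and> \<not> F \<subseteq> \<tau> \<and> \<tau> \<union> F \<in> K}"

definition stellar_step :: "'a set set \<Rightarrow> 'a set set \<Rightarrow> bool" where
  "stellar_step K L \<longleftrightarrow>
     (\<exists>F v. F \<in> K \<and> F \<noteq> {} \<and> v \<notin> \<Union>K \<and> L = stellar_subdivision K F v)"

text \<open>Finite complexes are considered up to isomorphism. The subdivisions are carried out on a copy
  with vertices in \<^typ>\<open>nat\<close>, where a new vertex is always available.\<close>

definition obtainable_by_stellar_subdivisions :: "'a set set \<Rightarrow> 'b set set \<Rightarrow> bool" where
  "obtainable_by_stellar_subdivisions K L \<longleftrightarrow>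
     (\<exists>K' L' :: nat set set. complex_iso K K' \<and> stellar_step\<^sup>*\<^sup>* K' L' \<and> complex_iso L' L)"

definition order_complex :: "('a \<Rightarrow> 'a \<Rightarrow> bool) \<Rightarrow> 'a set \<Rightarrow> 'a set set" where
  "order_complex le P = {C. C \<subseteq> P \<and> finite C \<and> Complete_Partial_Order.chain le C}"


section \<open>The partition lattice\<close>

text \<open>The order on partitions of \<open>{1..n}\<close> is \<^term>\<open>refines {1..n}\<close>: a partition is below those that it
  refines, so the partition into singletons is the least element.\<close>

definition partition_lattice :: "nat \<Rightarrow> nat set set set" where
  "partition_lattice n = {P. partition_on {1..n} P}"

definition proper_partitions :: "nat \<Rightarrow> nat set set set" where
  "proper_partitions n = partition_lattice n - {(\<lambda>i. {i}) ` {1..n}, {{1..n}}}"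


section \<open>Rooted trees with labelled leaves\<close>

text \<open>Edges are two-element sets of vertices; \<open>leaf_of i\<close> is the leaf with label \<open>i\<close>, and only its
  values on \<open>{1..n}\<close> are relevant.\<close>

record 'v rtree =
  verts :: "'v set"
  edges :: "'v set set"
  root_of :: 'v
  leaf_of :: "nat \<Rightarrow> 'v"

definition path_edges :: "'v list \<Rightarrow> 'v set set" where
  "path_edges p = {{a, b} | a b. (a, b) \<in> set (zip p (tl p))}"

definition path_between :: "'v set set \<Rightarrow> 'v \<Rightarrow> 'v list \<Rightarrow> 'v \<Rightarrow> bool" where
  "path_between E u p v \<longleftrightarrow>
     p \<noteq> [] \<and> hd p = u \<and> last p = v \<and> distinct p \<and> path_edges p \<subseteq> E"

definition has_cycle :: "'v set set \<Rightarrow> bool" where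
  "has_cycle E \<longleftrightarrow> (\<exists>u p v. path_between E u p v \<and> length p \<ge> 3 \<and> {v, u} \<in> E)"

definition degree :: "'v rtree \<Rightarrow> 'v \<Rightarrow> nat" where
  "degree T v = card {e \<in> edges T. v \<in> e}"

definition leaves :: "'v rtree \<Rightarrow> 'v set" where
  "leaves T = {v \<in> verts T. degree T v = 1}"

definition tree_graph :: "'v rtree \<Rightarrow> bool" where
  "tree_graph T \<longleftrightarrow>
     finite (verts T) \<and>
     edges T \<subseteq> {{u, v} | u v. u \<in> verts T \<and> v \<in> verts T \<and> u \<noteq> v} \<and>
     (\<forall>u\<in>verts T. \<forall>v\<in>verts T. \<exists>p. path_between (edges T) u p v) \<and>
     \<not> has_cycle (edges T)"

definition labelled_tree :: "nat \<Rightarrow> 'v rtree \<Rightarrow> bool" where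
  "labelled_tree n T \<longleftrightarrow>
     tree_graph T \<and>
     root_of T \<in> verts T \<and> degree T (root_of T) > 1 \<and>
     (\<forall>v \<in> verts T - leaves T - {root_of T}. degree T v \<ge> 3) \<and>
     bij_betw (leaf_of T) {1..n} (leaves T)"

definition outdegree :: "'v rtree \<Rightarrow> 'v \<Rightarrow> nat" where
  "outdegree T v =
     card {e \<in> edges T. v \<in> e \<and>
             (\<forall>p. path_between (edges T) v p (root_of T) \<longrightarrow> e \<notin> path_edges p)}"

definition binary_tree :: "nat \<Rightarrow> 'v rtree \<Rightarrow> bool" where
  "binary_tree n T \<longleftrightarrow> labelled_tree n T \<and> (\<forall>v \<in> verts T - leaves T. outdegree T v = 2)"

definition internal_edges :: "'v rtree \<Rightarrow> 'v set set" where
  "internal_edges T = {e \<in> edges T. e \<inter> leaves T = {}}"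

text \<open>As no vertex other than the root has degree two, homeomorphisms of cell complexes that preserve
  root and labels amount to graph isomorphisms with this property.\<close>

definition tree_iso :: "nat \<Rightarrow> 'v rtree \<Rightarrow> 'w rtree \<Rightarrow> bool" where
  "tree_iso n S T \<longleftrightarrow>
     (\<exists>f. bij_betw f (verts S) (verts T) \<and> (`) f ` edges S = edges T \<and>
          f (root_of S) = root_of T \<and> (\<forall>i\<in>{1..n}. f (leaf_of S i) = leaf_of T i))"

text \<open>Every finite tree is isomorphic to one with vertices in \<^typ>\<open>nat\<close>, so the equivalence classes of
  such trees represent all combinatorial types.\<close>

definition combinatorial_type :: "nat \<Rightarrow> 'v rtree \<Rightarrow> nat rtree set" where
  "combinatorial_type n T = {T'. labelled_tree n T' \<and> tree_iso n T T'}"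

text \<open>Contracting a set \<open>C\<close> of edges: the vertices of the contracted tree are the connected components
  of the graph with edge set \<open>C\<close>.\<close>

definition component :: "'v set set \<Rightarrow> 'v \<Rightarrow> 'v set" where
  "component C v = {w. \<exists>p. path_between C v p w}"

definition contract :: "'v rtree \<Rightarrow> 'v set set \<Rightarrow> 'v set rtree" where
  "contract T C =
     \<lparr>verts = component C ` verts T,
      edges = (\<lambda>e. component C ` e) ` (edges T - C),
      root_of = component C (root_of T),
      leaf_of = component C \<circ> leaf_of T\<rparr>"


section \<open>The complex of trees\<close>

definition tree_simplex :: "nat \<Rightarrow> 'v rtree \<Rightarrow> nat rtree set set" where
  "tree_simplex n T =
     {combinatorial_type n (contract T (internal_edges T - {e})) | e. e \<in> internal_edges T}"

text \<open>Contracting all \<open>n - 2\<close> internal edges of a binary tree gives the empty simplex.\<close>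

definition tree_complex :: "nat \<Rightarrow> nat rtree set set set" where
  "tree_complex n =
     {tree_simplex n (contract B C) | (B :: nat rtree) C.
        binary_tree n B \<and> C \<subseteq> internal_edges B}"

end

theory Submission
  imports Defs
begin

text \<open>The clusters of a rooted tree with labelled leaves are the sets of leaves beyond its internal
  edges. Clusters of the same tree are nested or disjoint, and contracting other internal edges does
  not change a cluster. A tree with a single internal edge is determined up to isomorphism by its
  cluster, so a simplex of the complex of trees amounts to a laminar family of sets of at least two
  and fewer than \<open>n\<close> labels. Conversely, every such family extends to the clusters of a binary tree,
  so all of them occur (\<open>tree_complex_eq\<close>).

  A cluster \<open>S\<close> is also a partition of the labels, with \<open>S\<close> as its only block with more than one
  element. The vertices of the order complex that are missing are the proper partitions with at least
  two such blocks. They are inserted one by one, from coarse to fine: the new vertex \<open>x\<close> subdivides the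
  simplex whose vertices are the nontrivial blocks of \<open>x\<close>. After the members of a set \<open>U\<close> of such
  partitions have been inserted, the simplices are the sets in which every member of \<open>U\<close> is comparable
  to all other elements, while the remaining elements form a laminar family in which no two or more
  disjoint clusters have their join in \<open>U\<close>. These are the nested sets of Feichtner and Kozlov for the
  building set that consists of the clusters, of \<open>U\<close> and of the top of the lattice. Inserting \<open>x\<close>
  preserves this description (\<open>nested_complex_insert\<close>), since all coarser partitions are already
  present: a cluster incomparable to \<open>x\<close> would, with the blocks of \<open>x\<close> disjoint from it, have a join
  in \<open>U\<close>. If \<open>U\<close> is empty, the description is that of the laminar families. If \<open>U\<close> contains all
  partitions with at least two nontrivial blocks, disjoint clusters cannot occur together, and what
  remains are the chains (\<open>nested_complex_composites\<close>).\<close>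

section \<open>Trees as connected graphs all of whose edges are bridges\<close>

definition joined :: "'v set set \<Rightarrow> 'v \<Rightarrow> 'v \<Rightarrow> bool" where
  "joined E = (\<lambda>a b. {a, b} \<in> E)\<^sup>*\<^sup>*"

lemma joined_refl [simp]: "joined E u u"
  by (simp add: joined_def)

lemma joined_edge: "{u, v} \<in> E \<Longrightarrow> joined E u v"
  by (simp add: joined_def r_into_rtranclp)

lemma joined_trans: "joined E u v \<Longrightarrow> joined E v w \<Longrightarrow> joined E u w"
  by (simp add: joined_def)

lemma joined_sym: "joined E u v \<Longrightarrow> joined E v u"
  unfolding joined_def
proof (induction rule: rtranclp_induct)
  case (step v w)
  then have "{w, v} \<in> E" by (simp add: insert_commute)
  with step.IH show ?case by (rule converse_rtranclp_into_rtranclp[rotated])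
qed simp

lemma joined_mono: "joined D u v \<Longrightarrow> D \<subseteq> E \<Longrightarrow> joined E u v"
  unfolding joined_def by (erule rtranclp_mono[THEN predicate2D, rotated]) auto

lemma joined_closed:
  assumes "joined E u v" "u \<in> U" "\<And>a b. {a, b} \<in> E \<Longrightarrow> a \<in> U \<Longrightarrow> b \<in> U"
  shows "v \<in> U"
  using assms(1) unfolding joined_def
  by (induction rule: rtranclp_induct) (auto simp: assms(2) intro: assms(3))

lemma joined_avoiding:
  assumes "joined D u v" and "\<And>w. joined D u w \<Longrightarrow> w \<notin> f"
  shows "joined (D - {f}) u v"
proof -
  have "v \<in> {w. joined D u w \<and> joined (D - {f}) u w}"
  proof (rule joined_closed[OF assms(1)])
    fix a b assume "{a, b} \<in> D" and "a \<in> {w. joined D u w \<and> joined (D - {f}) u w}"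
    moreover from this assms(2)[of a] have "{a, b} \<in> D - {f}" by auto
    ultimately show "b \<in> {w. joined D u w \<and> joined (D - {f}) u w}"
      by (blast intro: joined_trans joined_edge)
  qed simp
  then show ?thesis by simp
qed

lemma path_edges_simps [simp]:
  "path_edges [] = {}" "path_edges [a] = {}"
  "path_edges (a # b # p) = insert {a, b} (path_edges (b # p))"
  by (auto simp: path_edges_def)

lemma path_edges_subset_iff: "path_edges p \<subseteq> E \<longleftrightarrow> successively (\<lambda>a b. {a, b} \<in> E) p"
  by (induction p rule: induct_list012) auto

lemma path_edges_vertices: "e \<in> path_edges p \<Longrightarrow> e \<subseteq> set p"
  by (induction p rule: induct_list012) auto

lemma path_imp_joined: "path_between E u p v \<Longrightarrow> joined E u v"
proof (induction p arbitrary: u)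
  case (Cons a p)
  show ?case
  proof (cases p)
    case Nil
    then show ?thesis using Cons.prems by (auto simp: path_between_def)
  next
    case (Cons b q)
    then have "{u, b} \<in> E" "path_between E b p v"
      using Cons.prems by (auto simp: path_between_def)
    then show ?thesis by (blast intro: Cons.IH joined_edge joined_trans)
  qed
qed (simp add: path_between_def)

text \<open>A walk becomes a path by returning to the first visit whenever a vertex is met again.\<close>

lemma joined_iff_path: "joined E u v \<longleftrightarrow> (\<exists>p. path_between E u p v)"
proof
  assume "joined E u v"
  then show "\<exists>p. path_between E u p v" unfolding joined_def
  proof (induction rule: rtranclp_induct)
    case base
    have "path_between E u [u] u" by (simp add: path_between_def)
    then show ?case ..
  next
    case (step v w)
    then obtain p where p: "path_between E u p v" by blast
    show ?case
    proof (cases "w \<in> set p")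
      case True
      then obtain xs ys where "p = (xs @ [w]) @ ys" by (metis append.assoc append_Cons append_Nil split_list)
      moreover from this p have "successively (\<lambda>a b. {a, b} \<in> E) ((xs @ [w]) @ ys)"
        unfolding path_between_def path_edges_subset_iff by blast
      then have "successively (\<lambda>a b. {a, b} \<in> E) (xs @ [w])"
        by (subst (asm) successively_append_iff) blast
      ultimately have "path_between E u (xs @ [w]) w"
        using p by (cases xs) (auto simp: path_between_def path_edges_subset_iff)
      then show ?thesis ..
    next
      case False
      then have "path_between E u (p @ [w]) w"
        using p step.hyps
        by (auto simp: path_between_def path_edges_subset_iff successively_append_iff)
      then show ?thesis ..
    qed
  qed
qed (auto intro: path_imp_joined)

lemma component_eq: "component C v = {w. joined C v w}"
  by (simp add: component_def joined_iff_path)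

lemma component_eq_iff: "component C u = component C v \<longleftrightarrow> joined C u v"
  unfolding component_eq by (auto intro: joined_trans joined_sym)

text \<open>A path visits its first vertex only once, so an edge at this vertex can only be its first edge.\<close>

lemma path_first_edge:
  assumes "path_between E v p r" "{v, w} \<in> path_edges p"
  shows "joined (E - {{v, w}}) w r"
proof -
  from assms obtain a q where p: "p = v # a # q"
    by (cases p rule: list.exhaust; cases "tl p") (auto simp: path_between_def)
  then have fresh: "v \<notin> set (a # q)" using assms by (auto simp: path_between_def)
  with p assms(2) path_edges_vertices[of "{v, w}" "a # q"] have [simp]: "a = w"
    by (auto simp: doubleton_eq_iff)
  have "path_edges (a # q) \<subseteq> E - {{v, w}}"
    using assms(1) p fresh path_edges_vertices[of "{v, w}" "a # q"]
    by (auto simp: path_between_def)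
  then have "path_between (E - {{v, w}}) w (a # q) r"
    using assms(1) p by (auto simp: path_between_def)
  then show ?thesis by (rule path_imp_joined)
qed

definition bridge_tree :: "'v set \<Rightarrow> 'v set set \<Rightarrow> bool" where
  "bridge_tree V E \<longleftrightarrow>
     finite V \<and> (\<forall>e\<in>E. \<exists>u\<in>V. \<exists>v\<in>V. e = {u, v}) \<and>
     (\<forall>u\<in>V. \<forall>v\<in>V. joined E u v) \<and>
     (\<forall>u v. {u, v} \<in> E \<longrightarrow> \<not> joined (E - {{u, v}}) u v)"

lemma bridge_treeD:
  assumes "bridge_tree V E"
  shows "finite V" "e \<in> E \<Longrightarrow> \<exists>u\<in>V. \<exists>v\<in>V. e = {u, v}" "u \<in> V \<Longrightarrow> v \<in> V \<Longrightarrow> joined E u v"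
    "{u, v} \<in> E \<Longrightarrow> \<not> joined (E - {{u, v}}) u v"
  using assms unfolding bridge_tree_def by metis+

lemma bridge_tree_ends:
  assumes "bridge_tree V E" "{u, v} \<in> E"
  shows "u \<in> V" "v \<in> V" "u \<noteq> v"
proof -
  obtain a b where ab: "a \<in> V" "b \<in> V" "{u, v} = {a, b}"
    using bridge_treeD(2)[OF assms] by metis
  show "u \<in> V" using ab by (metis insertI1 insertE singletonD)
  show "v \<in> V" using ab by (metis insertI1 insertI2 insertE singletonD)
  show "u \<noteq> v" using bridge_treeD(4)[OF assms] by (metis joined_refl)
qed

text \<open>A cycle is a path of length at least two that is closed by an edge outside of it, so a cycle
  through an edge is the same as a way around that edge.\<close>

lemma tree_graph_iff_bridge_tree: "tree_graph T \<longleftrightarrow> bridge_tree (verts T) (edges T)"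
proof -
  let ?V = "verts T" and ?E = "edges T"
  have cyc: "has_cycle ?E \<longleftrightarrow> (\<exists>u v. {u, v} \<in> ?E \<and> joined (?E - {{u, v}}) u v)"
    if loopfree: "\<And>u v. {u, v} \<in> ?E \<Longrightarrow> u \<noteq> v"
  proof
    assume "has_cycle ?E"
    then obtain u p v where p: "path_between ?E u p v" "length p \<ge> 3" "{u, v} \<in> ?E"
      by (auto simp: has_cycle_def insert_commute)
    have "{u, v} \<notin> path_edges p"
    proof
      assume "{u, v} \<in> path_edges p"
      obtain a b q where q: "p = u # a # b # q"
        using p(1,2) by (cases p rule: list.exhaust; cases "tl p"; cases "tl (tl p)")
          (auto simp: path_between_def)
      then have fresh: "u \<notin> set (a # b # q)" and v: "v = last (b # q)" "a \<notin> set (b # q)"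
        using p(1) by (auto simp: path_between_def)
      from fresh have "{u, v} \<notin> path_edges (a # b # q)"
        using path_edges_vertices by (metis insert_subset)
      with \<open>{u, v} \<in> path_edges p\<close> q fresh v have "v = a" by (auto simp: doubleton_eq_iff)
      moreover have "v \<in> set (b # q)" using v by (metis last_in_set list.distinct(1))
      ultimately show False using v by blast
    qed
    then have "path_between (?E - {{u, v}}) u p v" using p by (auto simp: path_between_def)
    from path_imp_joined[OF this] p show "\<exists>u v. {u, v} \<in> ?E \<and> joined (?E - {{u, v}}) u v"
      by blast
  next
    assume "\<exists>u v. {u, v} \<in> ?E \<and> joined (?E - {{u, v}}) u v"
    then obtain u v p where uv: "{u, v} \<in> ?E" and p: "path_between (?E - {{u, v}}) u p v"
      by (auto simp: joined_iff_path)
    have "length p \<noteq> 0" "length p \<noteq> 1" "length p \<noteq> 2"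
      using p loopfree[OF uv]
      by (auto simp: path_between_def length_Suc_conv numeral_2_eq_2)
    then have "length p \<ge> 3" by linarith
    moreover have "path_between ?E u p v" using p by (auto simp: path_between_def)
    ultimately show "has_cycle ?E"
      using uv unfolding has_cycle_def by (metis insert_commute)
  qed
  show ?thesis
  proof
    assume T: "tree_graph T"
    then have ends: "\<exists>u\<in>?V. \<exists>v\<in>?V. e = {u, v} \<and> u \<noteq> v" if "e \<in> ?E" for e
      using T that unfolding tree_graph_def by blast
    have "u \<noteq> v" if "{u, v} \<in> ?E" for u v
      using ends[OF that] by (auto simp: doubleton_eq_iff)
    with T cyc have "\<forall>u v. {u, v} \<in> ?E \<longrightarrow> \<not> joined (?E - {{u, v}}) u v"
      by (simp add: tree_graph_def)
    with T ends show "bridge_tree ?V ?E"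
      unfolding tree_graph_def bridge_tree_def joined_iff_path[symmetric] by blast
  next
    assume T: "bridge_tree ?V ?E"
    have loopfree: "{u, v} \<in> ?E \<Longrightarrow> u \<noteq> v" for u v using bridge_tree_ends[OF T] by metis
    have "?E \<subseteq> {{u, v} | u v. u \<in> ?V \<and> v \<in> ?V \<and> u \<noteq> v}"
    proof
      fix e assume "e \<in> ?E"
      with bridge_treeD(2)[OF T] obtain u v where "u \<in> ?V" "v \<in> ?V" "e = {u, v}" by blast
      with \<open>e \<in> ?E\<close> loopfree show "e \<in> {{u, v} | u v. u \<in> ?V \<and> v \<in> ?V \<and> u \<noteq> v}" by blast
    qed
    moreover have "\<not> has_cycle ?E" using T cyc[OF loopfree] by (simp add: bridge_tree_def)
    ultimately show "tree_graph T"
      using T unfolding tree_graph_def bridge_tree_def joined_iff_path[symmetric] by blast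
  qed
qed

lemma two_sides:
  assumes "bridge_tree V E" "{a, b} \<in> E" "u \<in> V"
  shows "joined (E - {{a, b}}) a u \<or> joined (E - {{a, b}}) b u"
proof -
  let ?U = "{w. joined (E - {{a, b}}) a w \<or> joined (E - {{a, b}}) b w}"
  have "u \<in> ?U"
  proof (rule joined_closed)
    show "joined E a u"
      using bridge_treeD(3)[OF assms(1)] bridge_tree_ends[OF assms(1,2)] assms(3) by metis
    fix c d assume cd: "{c, d} \<in> E" "c \<in> ?U"
    show "d \<in> ?U"
    proof (cases "{c, d} = {a, b}")
      case True
      then have "d = a \<or> d = b" by (metis insertI1 insertI2 insertE singletonD)
      then show ?thesis by auto
    next
      case False
      then have "joined (E - {{a, b}}) c d" using cd(1) by (intro joined_edge) simp
      then show ?thesis using cd(2) joined_trans[of "E - {{a, b}}"] by simp metis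
    qed
  qed simp
  then show ?thesis by simp
qed

text \<open>The part of the tree beyond the edge \<open>{x, w}\<close> never meets \<open>x\<close>, so it survives the removal of any
  other edge at \<open>x\<close>.\<close>

lemma beyond_edge:
  assumes "bridge_tree V E" "{x, w} \<in> E" "joined (E - {{x, w}}) w l" "x \<in> e" "e \<noteq> {x, w}"
    "e \<in> E"
  shows "joined (E - {e}) x l"
proof -
  have "joined (E - {{x, w}} - {e}) w l"
  proof (rule joined_avoiding[OF assms(3)])
    have *: "\<not> joined (E - {{x, w}}) x w" using bridge_treeD(4)[OF assms(1,2)] .
    fix z assume z: "joined (E - {{x, w}}) w z"
    show "z \<notin> e"
    proof
      assume "z \<in> e"
      have "x \<noteq> z" using * z joined_sym by metis
      obtain p q where "e = {p, q}" using bridge_treeD(2)[OF assms(1,6)] by metis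
      with \<open>z \<in> e\<close> \<open>x \<noteq> z\<close> assms(4) have "e = {x, z}" by auto
      with assms(5,6) have "joined (E - {{x, w}}) x z" by (intro joined_edge) simp
      with * z show False using joined_trans joined_sym by metis
    qed
  qed
  then have "joined (E - {e}) w l" by (rule joined_mono) blast
  moreover have "joined (E - {e}) x w" using assms(2,5) by (intro joined_edge) simp
  ultimately show ?thesis by (rule joined_trans[rotated])
qed

text \<open>Walking away from \<open>y\<close> through the edge \<open>{y, z}\<close> one can never turn back, so in a finite tree the
  walk ends in a vertex of degree one. The induction is on the size of the part beyond the edge.\<close>

lemma leaf_beyond_edge:
  assumes "bridge_tree V E" "{y, z} \<in> E"
  shows "\<exists>l\<in>V. card {e \<in> E. l \<in> e} = 1 \<and> joined (E - {{y, z}}) z l"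
  using assms(2)
proof (induction "card {w \<in> V. joined (E - {{y, z}}) z w}" arbitrary: y z rule: less_induct)
  case less
  note T = assms(1)
  note yz = bridge_tree_ends[OF T less.prems]
  show ?case
  proof (cases "{e \<in> E. z \<in> e} = {{y, z}}")
    case True
    then show ?thesis using yz by (intro bexI[of _ z]) simp_all
  next
    case False
    moreover have "{y, z} \<in> {e \<in> E. z \<in> e}" using less.prems by simp
    ultimately obtain f where f: "f \<in> E" "z \<in> f" "f \<noteq> {y, z}" by blast
    with bridge_treeD(2)[OF T f(1)] obtain w where w: "f = {z, w}" by auto
    have sub: "joined (E - {{y, z}}) z u" if "joined (E - {{z, w}}) w u" for u
      by (rule beyond_edge[OF T _ that]) (use f w less.prems in auto)
    let ?near = "{u \<in> V. joined (E - {{y, z}}) z u}"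
      and ?far = "{u \<in> V. joined (E - {{z, w}}) w u}"
    have "z \<notin> ?far" using bridge_treeD(4)[OF T] f w joined_sym by fastforce
    then have "?far \<subset> ?near" using sub yz(2) by auto
    then have "card ?far < card ?near"
      using bridge_treeD(1)[OF T] by (intro psubset_card_mono) auto
    from less.hyps[OF this] f w sub show ?thesis by blast
  qed
qed

text \<open>Contractions of labelled trees are easily seen to have these properties, and clusters can be read
  off from them.\<close>

definition leaf_labelled :: "nat \<Rightarrow> 'v rtree \<Rightarrow> bool" where
  "leaf_labelled n T \<longleftrightarrow>
     bridge_tree (verts T) (edges T) \<and> root_of T \<in> verts T - leaves T \<and>
     bij_betw (leaf_of T) {1..n} (leaves T)"

lemma leaf_labelledD:
  assumes "leaf_labelled n T"
  shows "bridge_tree (verts T) (edges T)" "root_of T \<in> verts T" "root_of T \<notin> leaves T"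
    "inj_on (leaf_of T) {1..n}" "leaf_of T ` {1..n} = leaves T"
  using assms by (auto simp: leaf_labelled_def bij_betw_def)

lemma labelled_tree_imp_leaf_labelled: "labelled_tree n T \<Longrightarrow> leaf_labelled n T"
  by (auto simp: labelled_tree_def leaf_labelled_def tree_graph_iff_bridge_tree leaves_def)

lemma leaf_edge_unique:
  assumes "l \<in> leaves T" "e \<in> edges T" "f \<in> edges T" "l \<in> e" "l \<in> f"
  shows "e = f"
proof -
  have "card {e \<in> edges T. l \<in> e} = 1" using assms(1) by (simp add: leaves_def degree_def)
  then obtain x where "{e \<in> edges T. l \<in> e} = {x}" by (auto simp: card_Suc_eq)
  with assms show ?thesis by (metis (mono_tags, lifting) mem_Collect_eq singletonD)
qed


section \<open>Clusters\<close>

definition cluster :: "nat \<Rightarrow> 'v rtree \<Rightarrow> 'v set \<Rightarrow> nat set" where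
  "cluster n T e = {i \<in> {1..n}. \<not> joined (edges T - {e}) (leaf_of T i) (root_of T)}"

text \<open>The edge \<open>f\<close> lies on one side of \<open>e\<close>, so the other side of \<open>e\<close> stays connected when \<open>f\<close> is removed and
  is contained in a side of \<open>f\<close>.\<close>

lemma far_sides_laminar:
  assumes T: "bridge_tree V E" and r: "r \<in> V" and e: "e \<in> E" and f: "f \<in> E"
  defines "side \<equiv> \<lambda>e. {v \<in> V. \<not> joined (E - {e}) v r}"
  shows "side e \<inter> side f = {} \<or> side e \<subseteq> side f \<or> side f \<subseteq> side e"
proof (cases "e = f")
  case False
  obtain a b where ab: "f = {a, b}" using bridge_treeD(2)[OF T f] by blast
  then have "joined (E - {e}) a b" using f False by (intro joined_edge) simp
  then have ends: "joined (E - {e}) w a" if "joined (E - {e}) w x" "x \<in> f" for w x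
    using that ab joined_trans joined_sym by (metis insertE singletonD)
  have avoid: "joined (E - {f}) u v" if "joined (E - {e}) u v" "\<not> joined (E - {e}) u a" for u v
  proof (rule joined_mono)
    show "joined (E - {e} - {f}) u v"
      by (rule joined_avoiding[OF that(1)]) (use ends that(2) in metis)
  qed auto
  show ?thesis
  proof (cases "joined (E - {e}) a r")
    case True
    \<comment> \<open>Both ends of \<open>f\<close> are on the root side of \<open>e\<close>, hence the far side of \<open>e\<close> is connected without \<open>f\<close>.\<close>
    obtain c d where cd: "e = {c, d}" using bridge_treeD(2)[OF T e] by blast
    have sides: "joined (E - {e}) c w \<or> joined (E - {e}) d w" if "w \<in> V" for w
      using two_sides[OF T e[unfolded cd] that] unfolding cd .
    have far: "\<not> joined (E - {e}) w r" "w \<in> V" if "w \<in> side e" for w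
      using that unfolding side_def by simp_all
    have "\<exists>z. \<forall>w\<in>side e. joined (E - {e}) z w"
    proof (cases "joined (E - {e}) c r")
      case True
      then have "\<forall>w\<in>side e. joined (E - {e}) d w"
        using sides far joined_trans joined_sym by metis
      then show ?thesis ..
    next
      case False
      then have "joined (E - {e}) d r" using sides[OF r] by simp
      then have "\<forall>w\<in>side e. joined (E - {e}) c w"
        using sides far joined_trans joined_sym by metis
      then show ?thesis ..
    qed
    then have conn: "joined (E - {e}) u v" if "u \<in> side e" "v \<in> side e" for u v
      using that joined_trans joined_sym by metis
    have "v \<in> side f" if "u \<in> side e" "u \<in> side f" "v \<in> side e" for u v
    proof -
      have "\<not> joined (E - {e}) u a"
        using True that(1) unfolding side_def by (metis (no_types, lifting) joined_trans mem_Collect_eq)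
      then have "joined (E - {f}) u v" using avoid conn that by metis
      then show ?thesis
        using that unfolding side_def by (metis (no_types, lifting) joined_trans mem_Collect_eq)
    qed
    then show ?thesis by blast
  next
    case False
    have "v \<notin> side f" if "v \<in> V" "v \<notin> side e" for v
    proof -
      have "joined (E - {e}) r v" using that joined_sym[of _ v r] unfolding side_def by simp
      moreover have "\<not> joined (E - {e}) r a" using False joined_sym by metis
      ultimately have "joined (E - {f}) r v" by (rule avoid)
      then show ?thesis using joined_sym[of _ r v] unfolding side_def by simp
    qed
    moreover have "side f \<subseteq> V" unfolding side_def by blast
    ultimately show ?thesis by blast
  qed
qed blast

definition laminar :: "'a set set \<Rightarrow> bool" where
  "laminar F \<longleftrightarrow> (\<forall>S\<in>F. \<forall>T\<in>F. S \<inter> T = {} \<or> S \<subseteq> T \<or> T \<subseteq> S)"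

lemma clusters_laminar:
  assumes "leaf_labelled n T"
  shows "laminar (cluster n T ` edges T)"
proof -
  note T = leaf_labelledD[OF assms]
  define side where "side = (\<lambda>e. {v \<in> verts T. \<not> joined (edges T - {e}) v (root_of T)})"
  have "leaf_of T i \<in> verts T" if "i \<in> {1..n}" for i
    using T(5) that by (auto simp: leaves_def)
  then have *: "cluster n T e = {i \<in> {1..n}. leaf_of T i \<in> side e}" for e
    unfolding cluster_def side_def by blast
  have "side e \<inter> side f = {} \<or> side e \<subseteq> side f \<or> side f \<subseteq> side e"
    if "e \<in> edges T" "f \<in> edges T" for e f
    using far_sides_laminar[OF T(1,2) that] unfolding side_def .
  then show ?thesis unfolding laminar_def * by blast
qed

text \<open>At least two further edges leave the far end of an internal edge, at least one further edge leaves
  the near end, and beyond each of them there is a leaf.\<close>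

lemma cluster_size:
  assumes "labelled_tree n T" "e \<in> internal_edges T"
  shows "2 \<le> card (cluster n T e)" "card (cluster n T e) < n"
proof -
  let ?E = "edges T" and ?r = "root_of T"
  note T = leaf_labelledD[OF labelled_tree_imp_leaf_labelled[OF assms(1)]]
  have e: "e \<in> ?E" "e \<inter> leaves T = {}" using assms(2) by (auto simp: internal_edges_def)
  obtain a b where ab: "a \<in> verts T" "b \<in> verts T" "e = {a, b}" using bridge_treeD(2)[OF T(1) e(1)] by blast
  then have "{a, b} \<in> ?E" using e by simp
  note sep = bridge_treeD(4)[OF T(1) this, folded ab(3)]
    and sides = two_sides[OF T(1) this T(2), folded ab(3)]
  have "\<exists>x y. e = {x, y} \<and> joined (?E - {e}) y ?r \<and> \<not> joined (?E - {e}) x ?r"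
  proof (cases "joined (?E - {e}) a ?r")
    case True
    then have "\<not> joined (?E - {e}) b ?r" using sep joined_trans joined_sym by metis
    then show ?thesis using True ab(3) insert_commute by metis
  next
    case False
    then show ?thesis using sides joined_sym ab(3) by metis
  qed
  then obtain x y where xy: "e = {x, y}" "joined (?E - {e}) y ?r" "\<not> joined (?E - {e}) x ?r"
    by metis
  have deg: "v \<noteq> ?r \<Longrightarrow> 3 \<le> degree T v" "2 \<le> degree T v" if "v \<in> e" for v
  proof -
    have "v \<in> verts T - leaves T" using that e ab by auto
    then have "v \<noteq> ?r \<longrightarrow> 3 \<le> degree T v" "1 < degree T ?r"
      using assms(1) unfolding labelled_tree_def by blast+
    then show "v \<noteq> ?r \<Longrightarrow> 3 \<le> degree T v" "2 \<le> degree T v" by (cases "v = ?r"; simp)+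
  qed
  have other: "\<exists>f. f \<in> {f \<in> ?E. v \<in> f} \<and> f \<notin> A" if "card A < degree T v" "finite A" for v A
    using that unfolding degree_def by (meson card_mono leD subsetI)
  have leaf: "\<exists>i\<in>{1..n}. joined (?E - {f}) w (leaf_of T i)" if "f \<in> ?E" "f = {v, w}" for f v w
  proof -
    obtain l where l: "l \<in> verts T" "card {e \<in> ?E. l \<in> e} = 1" "joined (?E - {f}) w l"
      using leaf_beyond_edge[OF T(1)] \<open>f \<in> ?E\<close> unfolding \<open>f = {v, w}\<close> by blast
    then have "l \<in> leaves T" by (simp add: leaves_def degree_def)
    then obtain i where "i \<in> {1..n}" "l = leaf_of T i" using T(5) by blast
    then show ?thesis using l by blast
  qed
  have other_end: "\<exists>w. f = {v, w}" if "f \<in> ?E" "v \<in> f" for f v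
    using bridge_treeD(2)[OF T(1) that(1)] that(2) by auto
  obtain f where f: "f \<in> ?E" "x \<in> f" "f \<noteq> e"
    using other[of "{e}" x] deg(2)[of x] xy(1) by auto
  have "x \<noteq> ?r" using xy(3) by auto
  then obtain g where g: "g \<in> ?E" "x \<in> g" "g \<noteq> e" "g \<noteq> f"
    using other[of "{e, f}" x] deg(1)[of x] xy(1) card_insert_le_m1[of 2 "{f}" e] by auto
  obtain h where h: "h \<in> ?E" "y \<in> h" "h \<noteq> e"
    using other[of "{e}" y] deg(2)[of y] xy(1) by auto
  obtain u v w where uvw: "f = {x, u}" "g = {x, v}" "h = {y, w}"
    using other_end f g h by meson
  obtain i where i: "i \<in> {1..n}" "joined (?E - {f}) u (leaf_of T i)" using leaf f uvw by blast
  obtain j where j: "j \<in> {1..n}" "joined (?E - {g}) v (leaf_of T j)" using leaf g uvw by blast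
  obtain k where k: "k \<in> {1..n}" "joined (?E - {h}) w (leaf_of T k)" using leaf h uvw by blast
  note beyond = beyond_edge[OF T(1)]
  have xi: "joined (?E - {e}) x (leaf_of T i)"
    by (rule beyond[of x u]) (use i f e xy uvw in auto)
  have xj: "joined (?E - {e}) x (leaf_of T j)"
    by (rule beyond[of x v]) (use j g e xy uvw in auto)
  have yk: "joined (?E - {e}) y (leaf_of T k)"
    by (rule beyond[of y w]) (use k h e xy uvw in auto)
  have fj: "joined (?E - {f}) x (leaf_of T j)"
    by (rule beyond[of x v]) (use j g f uvw in auto)
  have "\<not> joined (?E - {f}) x u" using bridge_treeD(4)[OF T(1)] f uvw by auto
  then have "i \<noteq> j" using fj i joined_sym joined_trans by metis
  have "i \<in> cluster n T e" "j \<in> cluster n T e"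
    using xi xj xy(3) i j joined_trans unfolding cluster_def
    by (metis (mono_tags, lifting) mem_Collect_eq)+
  moreover have "k \<notin> cluster n T e"
    using yk xy(2) joined_trans joined_sym unfolding cluster_def
    by (metis (mono_tags, lifting) mem_Collect_eq)
  moreover have sub: "cluster n T e \<subseteq> {1..n}" by (auto simp: cluster_def)
  ultimately have "{i, j} \<subseteq> cluster n T e" "cluster n T e \<subset> {1..n}" using k by blast+
  moreover have "finite (cluster n T e)" using sub by (rule finite_subset) simp
  ultimately show "2 \<le> card (cluster n T e)" "card (cluster n T e) < n"
    using \<open>i \<noteq> j\<close> card_mono[of "cluster n T e" "{i, j}"] psubset_card_mono[of "{1..n}" "cluster n T e"]
    by simp_all
qed

section \<open>Contracting edges\<close>

text \<open>A walk in the contracted graph lifts to a walk that uses contracted edges in between.\<close>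

lemma joined_contract_iff:
  assumes "C \<subseteq> D" and ends: "\<And>e. e \<in> D \<Longrightarrow> \<exists>a b. e = {a, b}"
  shows "joined ((`) (component C) ` (D - C)) (component C u) (component C v) \<longleftrightarrow> joined D u v"
    (is "joined ?D' (?q u) (?q v) \<longleftrightarrow> _")
proof
  assume "joined ?D' (?q u) (?q v)"
  then have "?q v \<in> {x. \<forall>w. x = ?q w \<longrightarrow> joined D u w}"
  proof (rule joined_closed)
    show "?q u \<in> {x. \<forall>w. x = ?q w \<longrightarrow> joined D u w}"
      using joined_mono[OF _ assms(1)] by (auto simp: component_eq_iff)
    fix x y assume xy: "{x, y} \<in> ?D'" and x: "x \<in> {x. \<forall>w. x = ?q w \<longrightarrow> joined D u w}"
    from xy obtain e where e: "e \<in> D" "{x, y} = ?q ` e" by auto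
    with ends[OF e(1)] obtain c d where "{c, d} \<in> D" "{x, y} = {?q c, ?q d}" by auto
    then obtain a b where ab: "{a, b} \<in> D" "x = ?q a" "y = ?q b"
      by (metis doubleton_eq_iff insert_commute)
    have "joined D u w" if "y = ?q w" for w
    proof -
      have "joined C b w" using that ab(3) component_eq_iff by metis
      then have "joined D b w" by (rule joined_mono[OF _ assms(1)])
      moreover have "joined D a b" using ab(1) by (rule joined_edge)
      moreover have "joined D u a" using x ab(2) by simp
      ultimately show ?thesis using joined_trans by metis
    qed
    then show "y \<in> {x. \<forall>w. x = ?q w \<longrightarrow> joined D u w}" by simp
  qed
  then show "joined D u v" by simp
next
  assume "joined D u v"
  then have "v \<in> {w. joined ?D' (?q u) (?q w)}"
  proof (rule joined_closed)
    fix a b assume ab: "{a, b} \<in> D" "a \<in> {w. joined ?D' (?q u) (?q w)}"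
    have "joined ?D' (?q a) (?q b)"
    proof (cases "{a, b} \<in> C")
      case True
      then have "?q a = ?q b" using joined_edge component_eq_iff by metis
      then show ?thesis by simp
    next
      case False
      then have "?q ` {a, b} \<in> ?D'" using ab(1) by (intro imageI) simp
      then show ?thesis by (intro joined_edge) simp
    qed
    with ab(2) show "b \<in> {w. joined ?D' (?q u) (?q w)}"
      using joined_trans by simp
  qed simp
  then show "joined ?D' (?q u) (?q v)" by simp
qed

text \<open>If two edges had the same image, one of them would lead around the other.\<close>

lemma contract_inj_on_edges:
  assumes T: "bridge_tree V E" and C: "C \<subseteq> E"
  shows "inj_on ((`) (component C)) (E - C)"
proof (rule inj_onI, rule ccontr)
  fix e f
  assume e: "e \<in> E - C" and f: "f \<in> E - C" and img: "component C ` e = component C ` f"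
    and ne: "e \<noteq> f"
  obtain a b where ab: "e = {a, b}" using bridge_treeD(2)[OF T, of e] e by blast
  obtain c' d' where cd': "f = {c', d'}" using bridge_treeD(2)[OF T, of f] f by blast
  from img have "{component C a, component C b} = {component C c', component C d'}"
    by (simp add: ab cd')
  then obtain c d where cd: "f = {c, d}" "component C a = component C c" "component C b = component C d"
    unfolding cd' by (metis doubleton_eq_iff insert_commute)
  have "C \<subseteq> E - {e}" using e C by blast
  with cd have "joined (E - {e}) a c" "joined (E - {e}) d b"
    by (metis component_eq_iff joined_mono joined_sym)+
  moreover have "joined (E - {e}) c d" using f ne cd(1) by (intro joined_edge) blast
  ultimately have "joined (E - {e}) a b" using joined_trans by metis
  moreover have "{a, b} \<in> E" using e ab by simp
  ultimately show False using bridge_treeD(4)[OF T] ab by metis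
qed

lemma joined_contract_minus_iff:
  assumes T: "bridge_tree V E" and C: "C \<subseteq> E" and e: "e \<in> E - C"
  shows "joined ((`) (component C) ` (E - C) - {component C ` e}) (component C u) (component C v)
    \<longleftrightarrow> joined (E - {e}) u v"
proof -
  have "(`) (component C) ` (E - C) - {component C ` e} = (`) (component C) ` (E - C - {e})"
    using inj_on_image_set_diff[OF contract_inj_on_edges[OF T C], of "E - C" "{e}"] e by simp
  also have "E - C - {e} = (E - {e}) - C" by blast
  finally have *: "(`) (component C) ` (E - C) - {component C ` e} = (`) (component C) ` ((E - {e}) - C)" .
  show ?thesis unfolding *
  proof (rule joined_contract_iff)
    show "C \<subseteq> E - {e}" using C e by blast
    show "\<exists>a b. f = {a, b}" if "f \<in> E - {e}" for f using bridge_treeD(2)[OF T, of f] that by blast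
  qed
qed

lemma bridge_tree_contract:
  assumes T: "bridge_tree V E" and C: "C \<subseteq> E"
  shows "bridge_tree (component C ` V) ((`) (component C) ` (E - C))" (is "bridge_tree ?V ?E")
  unfolding bridge_tree_def
proof (intro conjI)
  show "finite ?V" using bridge_treeD(1)[OF T] by simp
  show ends: "\<forall>e\<in>?E. \<exists>u\<in>?V. \<exists>v\<in>?V. e = {u, v}"
  proof
    fix e assume "e \<in> ?E"
    then obtain f where "f \<in> E" "e = component C ` f" by blast
    with bridge_treeD(2)[OF T this(1)] show "\<exists>u\<in>?V. \<exists>v\<in>?V. e = {u, v}" by auto
  qed
  have "joined ?E (component C u) (component C v) \<longleftrightarrow> joined E u v" for u v
    by (rule joined_contract_iff[OF C]) (use bridge_treeD(2)[OF T] in blast)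
  then show "\<forall>u\<in>?V. \<forall>v\<in>?V. joined ?E u v" using bridge_treeD(3)[OF T] by auto
  show "\<forall>u v. {u, v} \<in> ?E \<longrightarrow> \<not> joined (?E - {{u, v}}) u v"
  proof (intro allI impI)
    fix u v assume "{u, v} \<in> ?E"
    then obtain e where e: "e \<in> E - C" "{u, v} = component C ` e" by blast
    obtain a b where ab: "e = {a, b}" using bridge_treeD(2)[OF T, of e] e(1) by blast
    have "\<not> joined (E - {e}) a b" "\<not> joined (E - {e}) b a"
      using bridge_treeD(4)[OF T] e(1) ab by (metis DiffD1 insert_commute)+
    moreover have "u = component C a \<and> v = component C b \<or> u = component C b \<and> v = component C a"
      using e(2) ab by (auto simp: doubleton_eq_iff)
    ultimately show "\<not> joined (?E - {{u, v}}) u v"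
      using joined_contract_minus_iff[OF T C e(1)] e(2) by metis
  qed
qed

context
  fixes n :: nat and T :: "'v rtree" and C :: "'v set set"
  assumes labelled: "leaf_labelled n T" and internal: "C \<subseteq> internal_edges T"
begin

private lemma C_edges: "C \<subseteq> edges T" and C_leaves: "e \<in> C \<Longrightarrow> l \<in> leaves T \<Longrightarrow> l \<notin> e"
  using internal by (auto simp: internal_edges_def)

private lemma component_leaf_iff:
  assumes "l \<in> leaves T"
  shows "component C v = component C l \<longleftrightarrow> v = l"
proof
  assume "component C v = component C l"
  then have "joined C l v" by (simp add: component_eq_iff[symmetric])
  then have "v \<in> {l}" by (rule joined_closed) (use C_leaves assms in auto)
  then show "v = l" by simp
qed simp

private lemma degree_contract:
  "degree (contract T C) (component C v) = card {e \<in> edges T - C. component C v \<in> component C ` e}"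
proof -
  have "{e \<in> edges (contract T C). component C v \<in> e} =
      (`) (component C) ` {e \<in> edges T - C. component C v \<in> component C ` e}"
    by (auto simp: contract_def)
  moreover have "inj_on ((`) (component C)) {e \<in> edges T - C. component C v \<in> component C ` e}"
    by (rule inj_on_subset[OF contract_inj_on_edges[OF leaf_labelledD(1)[OF labelled] C_edges]]) blast
  ultimately show ?thesis by (simp add: degree_def card_image)
qed

text \<open>A component of inner vertices with a single edge leaving it would be all that lies beyond this
  edge, but there is a leaf beyond every edge.\<close>

private lemma degree_contract_eq_one_iff:
  assumes v: "v \<in> verts T"
  shows "degree (contract T C) (component C v) = 1 \<longleftrightarrow> v \<in> leaves T"
proof
  note T = leaf_labelledD(1)[OF labelled]
  assume "degree (contract T C) (component C v) = 1"
  then obtain e where e: "{e \<in> edges T - C. component C v \<in> component C ` e} = {e}"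
    by (auto simp: degree_contract card_Suc_eq)
  then have "e \<in> edges T" "component C v \<in> component C ` e" by blast+
  then obtain x where x: "x \<in> e" "component C v = component C x" by blast
  with bridge_treeD(2)[OF T \<open>e \<in> edges T\<close>] obtain y where y: "e = {y, x}"
    by (metis doubleton_eq_iff insertE singletonD)
  then obtain l where l: "l \<in> verts T" "card {e \<in> edges T. l \<in> e} = 1" "joined (edges T - {e}) x l"
    using leaf_beyond_edge[OF T, of y x] \<open>e \<in> edges T\<close> by auto
  have only: "f \<in> C" if "f \<in> edges T" "f \<noteq> e" "component C v \<in> component C ` f" for f
  proof (rule ccontr)
    assume "f \<notin> C"
    with that have "f \<in> {e \<in> edges T - C. component C v \<in> component C ` e}" by simp
    with that(2) show False unfolding e by simp
  qed
  have "l \<in> {w. component C w = component C v}"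
  proof (rule joined_closed[OF l(3)])
    fix a b assume ab: "{a, b} \<in> edges T - {e}" and "a \<in> {w. component C w = component C v}"
    then have "component C v \<in> component C ` {a, b}" by auto
    with ab only[of "{a, b}"] have "{a, b} \<in> C" by simp
    then have "component C a = component C b" using joined_edge component_eq_iff by metis
    then show "b \<in> {w. component C w = component C v}"
      using \<open>a \<in> {w. component C w = component C v}\<close> by simp
  qed (use x in simp)
  moreover have "l \<in> leaves T" using l by (simp add: leaves_def degree_def)
  ultimately show "v \<in> leaves T" using component_leaf_iff by (metis mem_Collect_eq)
next
  assume "v \<in> leaves T"
  then have "{e \<in> edges T - C. component C v \<in> component C ` e} = {e \<in> edges T. v \<in> e}"
    using C_leaves component_leaf_iff[of v] by (fastforce simp: image_iff)
  then show "degree (contract T C) (component C v) = 1"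
    using \<open>v \<in> leaves T\<close> unfolding degree_contract by (simp add: leaves_def degree_def)
qed

lemma leaves_contract: "leaves (contract T C) = component C ` leaves T"
proof -
  have "leaves (contract T C) = component C ` {v \<in> verts T. degree (contract T C) (component C v) = 1}"
    by (auto simp: leaves_def contract_def)
  also have "{v \<in> verts T. degree (contract T C) (component C v) = 1} = leaves T"
    using degree_contract_eq_one_iff by (auto simp: leaves_def)
  finally show ?thesis .
qed

lemma internal_edges_contract:
  "internal_edges (contract T C) = (`) (component C) ` (internal_edges T - C)"
proof -
  have "component C ` e \<inter> component C ` leaves T = {} \<longleftrightarrow> e \<inter> leaves T = {}" for e
    using component_leaf_iff by (auto simp: disjoint_iff)
  then show ?thesis
    unfolding internal_edges_def leaves_contract by (auto simp: contract_def)
qed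

lemma leaf_labelled_contract: "leaf_labelled n (contract T C)"
  unfolding leaf_labelled_def
proof (intro conjI)
  note T = leaf_labelledD[OF labelled]
  show "bridge_tree (verts (contract T C)) (edges (contract T C))"
    using bridge_tree_contract[OF T(1) C_edges] by (simp add: contract_def)
  have "component C (root_of T) \<notin> component C ` leaves T"
    using T(3) component_leaf_iff by (metis imageE)
  then show "root_of (contract T C) \<in> verts (contract T C) - leaves (contract T C)"
    unfolding leaves_contract using T(2) by (simp add: contract_def)
  have "inj_on (component C) (leaves T)" using component_leaf_iff by (meson inj_onI)
  then show "bij_betw (leaf_of (contract T C)) {1..n} (leaves (contract T C))"
    unfolding leaves_contract bij_betw_def using T(4) T(5)[symmetric]
    by (simp add: contract_def comp_inj_on image_comp)
qed

lemma cluster_contract: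
  assumes "e \<in> edges T - C"
  shows "cluster n (contract T C) (component C ` e) = cluster n T e"
  using joined_contract_minus_iff[OF leaf_labelledD(1)[OF labelled] C_edges assms]
  by (simp add: cluster_def contract_def)

end


section \<open>Trees with a single internal edge\<close>

text \<open>This is the shape of all trees with a single internal edge \<open>{root, y}\<close>; the cluster of this edge
  is \<open>S\<close>.\<close>

definition spider :: "nat \<Rightarrow> nat set \<Rightarrow> 'v rtree \<Rightarrow> bool" where
  "spider n S T \<longleftrightarrow>
     (\<exists>y. y \<noteq> root_of T \<and> y \<notin> leaf_of T ` {1..n} \<and> root_of T \<notin> leaf_of T ` {1..n} \<and>
          inj_on (leaf_of T) {1..n} \<and> verts T = {root_of T, y} \<union> leaf_of T ` {1..n} \<and>
          edges T = insert {root_of T, y}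
            ((\<lambda>i. {leaf_of T i, if i \<in> S then y else root_of T}) ` {1..n}))"

text \<open>Every neighbour of an end of the internal edge is the other end or a leaf, so by connectedness there
  are no further vertices. The leaves that the internal edge cuts off from the root are those at the
  other end.\<close>

lemma single_internal_edge_imp_spider:
  assumes labelled: "leaf_labelled n T" and single: "internal_edges T = {e}"
  shows "spider n (cluster n T e) T"
proof -
  let ?E = "edges T" and ?r = "root_of T"
  note T = leaf_labelledD[OF labelled]
  have e: "e \<in> ?E" "e \<inter> leaves T = {}" using single by (auto simp: internal_edges_def)
  have inner: "{a, b} = e" if "{a, b} \<in> ?E" "a \<notin> leaves T" "b \<notin> leaves T" for a b
  proof -
    have "{a, b} \<in> internal_edges T" using that by (simp add: internal_edges_def)
    then show ?thesis using single by simp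
  qed
  have near: "v \<in> e \<or> v \<in> leaves T \<and> (\<exists>z\<in>e. {v, z} \<in> ?E)" if "v \<in> verts T" for v
  proof -
    obtain x where x: "x \<in> e" "x \<in> verts T" using bridge_treeD(2)[OF T(1) e(1)] by auto
    have "v \<in> {w. w \<in> e \<or> w \<in> leaves T \<and> (\<exists>z\<in>e. {w, z} \<in> ?E)}" (is "v \<in> ?U")
    proof (rule joined_closed)
      show "joined ?E x v" using bridge_treeD(3)[OF T(1) x(2) that] .
      show "x \<in> ?U" using x by simp
      fix a b assume ab: "{a, b} \<in> ?E" and a: "a \<in> ?U"
      show "b \<in> ?U"
      proof (cases "a \<in> e")
        case True
        then have "a \<notin> leaves T" using e by blast
        then show ?thesis using inner[OF ab] ab True by (cases "b \<in> leaves T") (auto simp: insert_commute)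
      next
        case False
        then obtain z where z: "a \<in> leaves T" "z \<in> e" "{a, z} \<in> ?E" using a by blast
        then have "{a, b} = {a, z}" using leaf_edge_unique[OF z(1) ab z(3)] by simp
        then have "b = z" by (auto simp: doubleton_eq_iff)
        then show ?thesis using z by simp
      qed
    qed
    then show ?thesis by simp
  qed
  have "?r \<in> e" using near[OF T(2)] T(3) by blast
  with bridge_treeD(2)[OF T(1) e(1)] obtain y where y: "e = {?r, y}" "y \<in> verts T"
    by (metis doubleton_eq_iff insertE singletonD)
  have "{?r, y} \<in> ?E" using e y by simp
  note br = bridge_treeD(4)[OF T(1) this, folded y(1)] and ends = bridge_tree_ends[OF T(1) this]
  have leaf_edge: "{leaf_of T i, if i \<in> cluster n T e then y else ?r} \<in> ?E" if i: "i \<in> {1..n}" for i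
  proof -
    let ?l = "leaf_of T i"
    have l: "?l \<in> leaves T" using T(5) i by blast
    then have le: "?l \<notin> e" using e by blast
    from l have "?l \<in> verts T" by (simp add: leaves_def)
    with near le obtain z where z: "z \<in> e" "{?l, z} \<in> ?E" by blast
    have "{?l, z} \<noteq> e" using le by blast
    then have lz: "joined (?E - {e}) ?l z" using z by (intro joined_edge) simp
    have "z = ?r \<longleftrightarrow> i \<notin> cluster n T e"
    proof
      assume "z = ?r"
      then show "i \<notin> cluster n T e" using lz by (simp add: cluster_def)
    next
      assume "i \<notin> cluster n T e"
      then have "joined (?E - {e}) ?r z" using lz i joined_sym joined_trans unfolding cluster_def
        by (metis (mono_tags, lifting) mem_Collect_eq)
      then show "z = ?r" using z(1) y(1) br by auto
    qed
    then show ?thesis using z y(1) by auto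
  qed
  have es: "?E = insert {?r, y} ((\<lambda>i. {leaf_of T i, if i \<in> cluster n T e then y else ?r}) ` {1..n})"
  proof (intro equalityI subsetI)
    fix f assume f: "f \<in> ?E"
    show "f \<in> insert {?r, y} ((\<lambda>i. {leaf_of T i, if i \<in> cluster n T e then y else ?r}) ` {1..n})"
    proof (cases "f \<inter> leaves T = {}")
      case True
      then have "f \<in> internal_edges T" using f by (simp add: internal_edges_def)
      then show ?thesis using single y(1) by simp
    next
      case False
      then obtain l where l: "l \<in> f" "l \<in> leaves T" by (metis disjoint_iff)
      then obtain i where i: "i \<in> {1..n}" "leaf_of T i \<in> f" "leaf_of T i \<in> leaves T"
        unfolding T(5)[symmetric] by (metis imageE)
      have "f = {leaf_of T i, if i \<in> cluster n T e then y else ?r}"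
        by (rule leaf_edge_unique[OF i(3) f leaf_edge[OF i(1)] i(2)]) simp
      then show ?thesis using i(1) by blast
    qed
  qed (use leaf_edge \<open>{?r, y} \<in> ?E\<close> in blast)
  have vs: "verts T = {?r, y} \<union> leaf_of T ` {1..n}"
  proof (intro equalityI subsetI)
    fix v assume "v \<in> verts T"
    with near show "v \<in> {?r, y} \<union> leaf_of T ` {1..n}" unfolding T(5) y(1) by blast
  next
    fix v assume "v \<in> {?r, y} \<union> leaf_of T ` {1..n}"
    then show "v \<in> verts T" unfolding T(5) using T(2) y(2) by (auto simp: leaves_def)
  qed
  have "y \<notin> leaf_of T ` {1..n}" using T(5) e y(1) by blast
  moreover have "?r \<notin> leaf_of T ` {1..n}" using T(3) unfolding T(5) .
  moreover have "y \<noteq> ?r" using ends(3) by (rule not_sym)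
  ultimately show ?thesis unfolding spider_def using vs es T(4) by (intro exI[of _ y] conjI)
qed

lemma spiderE:
  assumes "spider n S T"
  obtains y where "y \<noteq> root_of T" "y \<notin> leaf_of T ` {1..n}" "root_of T \<notin> leaf_of T ` {1..n}"
    "inj_on (leaf_of T) {1..n}" "verts T = {root_of T, y} \<union> leaf_of T ` {1..n}"
    "edges T = insert {root_of T, y}
       ((\<lambda>i. {leaf_of T i, if i \<in> S then y else root_of T}) ` {1..n})"
  using assms unfolding spider_def by (elim exE conjE) (rule that)

lemma spider_determines_cluster:
  assumes "spider n S T" "spider n S' T" "S \<subseteq> {1..n}" "S' \<subseteq> {1..n}"
  shows "S = S'"
proof -
  have "i \<notin> S \<longleftrightarrow> {leaf_of T i, root_of T} \<in> edges T" if "spider n S T" "i \<in> {1..n}" for S i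
  proof -
    let ?l = "leaf_of T" and ?r = "root_of T"
    obtain y where y: "y \<noteq> ?r" "y \<notin> ?l ` {1..n}" "?r \<notin> ?l ` {1..n}" "inj_on ?l {1..n}"
      and E: "edges T = insert {?r, y} ((\<lambda>i. {?l i, if i \<in> S then y else ?r}) ` {1..n})"
      using spiderE[OF \<open>spider n S T\<close>] .
    have ne: "?l i \<noteq> y" "?l i \<noteq> ?r" using y that(2) by (metis imageI)+
    show ?thesis
    proof
      assume "i \<notin> S"
      then show "{?l i, ?r} \<in> edges T" unfolding E using that(2) by auto
    next
      assume "{?l i, ?r} \<in> edges T"
      then obtain j where j: "j \<in> {1..n}" "{?l i, ?r} = {?l j, if j \<in> S then y else ?r}"
        unfolding E using ne by (auto simp: doubleton_eq_iff)
      then have "?l i = ?l j" "?r = (if j \<in> S then y else ?r)"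
        using ne y(1) by (auto simp: doubleton_eq_iff split: if_splits)
      moreover from this(1) have "i = j" using inj_onD[OF y(4)] that(2) j(1) by metis
      ultimately show "i \<notin> S" using y(1) by (simp split: if_splits)
    qed
  qed
  then show ?thesis using assms by blast
qed

lemma spider_tree_iso:
  assumes "spider n S T" "tree_iso n T T'"
  shows "spider n S T'"
proof -
  let ?l = "leaf_of T" and ?r = "root_of T" and ?l' = "leaf_of T'" and ?r' = "root_of T'"
  obtain y where y: "y \<noteq> ?r" "y \<notin> ?l ` {1..n}" "?r \<notin> ?l ` {1..n}" "inj_on ?l {1..n}"
    and V: "verts T = {?r, y} \<union> ?l ` {1..n}"
    and E: "edges T = insert {?r, y} ((\<lambda>i. {?l i, if i \<in> S then y else ?r}) ` {1..n})"
    using spiderE[OF assms(1)] .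
  obtain f where f: "bij_betw f (verts T) (verts T')" "(`) f ` edges T = edges T'" "f ?r = ?r'"
    "\<And>i. i \<in> {1..n} \<Longrightarrow> f (?l i) = ?l' i"
    using assms(2) unfolding tree_iso_def by metis
  have inj: "inj_on f (verts T)" using f(1) by (rule bij_betw_imp_inj_on)
  have l': "?l' ` {1..n} = f ` ?l ` {1..n}" using f(4) by force
  have sub: "?l ` {1..n} \<subseteq> verts T" "y \<in> verts T" "?r \<in> verts T" using V by auto
  show ?thesis unfolding spider_def
  proof (intro exI[of _ "f y"] conjI)
    show "f y \<noteq> ?r'" using inj_onD[OF inj _ sub(2,3)] y(1) f(3) by metis
    show "f y \<notin> ?l' ` {1..n}" "?r' \<notin> ?l' ` {1..n}"
      unfolding l' f(3)[symmetric]
      by (simp_all only: inj_on_image_mem_iff[OF inj sub(2,1)] inj_on_image_mem_iff[OF inj sub(3,1)]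
          y(2,3) not_False_eq_True)
    have "inj_on (f \<circ> ?l) {1..n}" using y(4) inj_on_subset[OF inj sub(1)] by (rule comp_inj_on)
    moreover have "(f \<circ> ?l) i = ?l' i" if "i \<in> {1..n}" for i using f(4)[OF that] by simp
    ultimately show "inj_on ?l' {1..n}" by (rule inj_on_cong[THEN iffD1, rotated])
    have "verts T' = f ` verts T" using f(1) by (simp add: bij_betw_def)
    then show "verts T' = {?r', f y} \<union> ?l' ` {1..n}" unfolding V l' by (simp add: f(3) image_Un)
    have "(\<lambda>i. f ` {?l i, if i \<in> S then y else ?r}) ` {1..n} =
        (\<lambda>i. {?l' i, if i \<in> S then f y else ?r'}) ` {1..n}"
      by (rule image_cong[OF refl]) (simp add: f(3,4))
    then show "edges T' = insert {?r', f y} ((\<lambda>i. {?l' i, if i \<in> S then f y else ?r'}) ` {1..n})"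
      unfolding f(2)[symmetric] E using f(3) by (simp add: image_image)
  qed
qed

lemma spiders_tree_iso:
  assumes "spider n S T" "spider n S T'"
  shows "tree_iso n T T'"
proof -
  let ?l = "leaf_of T" and ?r = "root_of T" and ?l' = "leaf_of T'" and ?r' = "root_of T'"
  obtain y where y: "y \<noteq> ?r" "y \<notin> ?l ` {1..n}" "?r \<notin> ?l ` {1..n}" "inj_on ?l {1..n}"
    and V: "verts T = {?r, y} \<union> ?l ` {1..n}"
    and E: "edges T = insert {?r, y} ((\<lambda>i. {?l i, if i \<in> S then y else ?r}) ` {1..n})"
    using spiderE[OF assms(1)] .
  obtain z where z: "z \<noteq> ?r'" "z \<notin> ?l' ` {1..n}" "?r' \<notin> ?l' ` {1..n}" "inj_on ?l' {1..n}"
    and V': "verts T' = {?r', z} \<union> ?l' ` {1..n}"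
    and E': "edges T' = insert {?r', z} ((\<lambda>i. {?l' i, if i \<in> S then z else ?r'}) ` {1..n})"
    using spiderE[OF assms(2)] .
  define f where "f v = (if v = ?r then ?r' else if v = y then z else ?l' (inv_into {1..n} ?l v))" for v
  have fr: "f ?r = ?r'" and fy: "f y = z" using y(1) by (simp_all add: f_def)
  have fl: "f (?l i) = ?l' i" if "i \<in> {1..n}" for i
  proof -
    have "?l i \<noteq> ?r" "?l i \<noteq> y" using y that by (metis imageI)+
    then show ?thesis using inv_into_f_f[OF y(4) that] by (simp add: f_def)
  qed
  have l': "f ` ?l ` {1..n} = ?l' ` {1..n}" using fl by force
  have "inj_on f (verts T)"
  proof -
    have "inj_on f (?l ` {1..n})"
    proof (rule inj_onI)
      fix u v assume uv: "u \<in> ?l ` {1..n}" "v \<in> ?l ` {1..n}" "f u = f v"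
      then obtain i j where ij: "i \<in> {1..n}" "u = ?l i" "j \<in> {1..n}" "v = ?l j" by blast
      then have "?l' i = ?l' j" using uv(3) fl by simp
      then have "i = j" using inj_onD[OF z(4)] ij by blast
      then show "u = v" using ij by simp
    qed
    then show ?thesis
      unfolding V insert_is_Un[symmetric] inj_on_insert Un_insert_left Un_empty_left
      using z(1,2,3) fr fy l' by auto
  qed
  moreover have "f ` verts T = verts T'" unfolding V V' using fr fy l' by simp
  ultimately have "bij_betw f (verts T) (verts T')" by (simp add: bij_betw_def)
  moreover have "(`) f ` edges T = edges T'"
  proof -
    have "(\<lambda>i. f ` {?l i, if i \<in> S then y else ?r}) ` {1..n} =
        (\<lambda>i. {?l' i, if i \<in> S then z else ?r'}) ` {1..n}"
      by (rule image_cong[OF refl]) (simp add: fr fy fl)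
    then show ?thesis unfolding E E' using fr fy by (simp add: image_image)
  qed
  ultimately show ?thesis unfolding tree_iso_def using fr fl by blast
qed

definition spider_type :: "nat \<Rightarrow> nat set \<Rightarrow> nat rtree set" where
  "spider_type n S = {T. labelled_tree n T \<and> spider n S T}"

lemma combinatorial_type_spider: "spider n S T \<Longrightarrow> combinatorial_type n T = spider_type n S"
  using spider_tree_iso spiders_tree_iso unfolding combinatorial_type_def spider_type_def by blast

text \<open>Contracting all internal edges but one keeps the cluster of the remaining edge, and the cluster
  determines the resulting type.\<close>

lemma combinatorial_type_contract_other_edges:
  assumes "leaf_labelled n T" "e \<in> internal_edges T"
  shows "combinatorial_type n (contract T (internal_edges T - {e})) = spider_type n (cluster n T e)"
proof -
  let ?C = "internal_edges T - {e}"
  have C: "?C \<subseteq> internal_edges T" by blast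
  have "internal_edges T - ?C = {e}" using assms(2) by blast
  then have single: "internal_edges (contract T ?C) = {component ?C ` e}"
    using internal_edges_contract[OF assms(1) C] by simp
  have "e \<in> edges T - ?C" using assms(2) by (simp add: internal_edges_def)
  note cluster_contract[OF assms(1) C this]
  moreover note single_internal_edge_imp_spider[OF leaf_labelled_contract[OF assms(1) C] single]
  ultimately show ?thesis using combinatorial_type_spider by metis
qed

lemma tree_simplex_eq:
  assumes "leaf_labelled n T"
  shows "tree_simplex n T = spider_type n ` cluster n T ` internal_edges T"
  using combinatorial_type_contract_other_edges[OF assms]
  unfolding tree_simplex_def by (auto simp: image_iff)

lemma tree_simplex_contract:
  assumes "leaf_labelled n T" "C \<subseteq> internal_edges T"
  shows "tree_simplex n (contract T C) = spider_type n ` cluster n T ` (internal_edges T - C)"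
proof -
  have "cluster n (contract T C) ` internal_edges (contract T C) = cluster n T ` (internal_edges T - C)"
    unfolding internal_edges_contract[OF assms] image_image
    by (rule image_cong[OF refl], rule cluster_contract[OF assms]) (simp add: internal_edges_def)
  then show ?thesis using tree_simplex_eq[OF leaf_labelled_contract[OF assms]] by simp
qed

section \<open>The tree of a laminar family\<close>

text \<open>The members of the family are the vertices, and every proper member is joined to the least member
  that strictly contains it. The singletons are the leaves. The injection \<open>g\<close> turns the members into
  natural numbers, which are the vertices of the trees in the complex of trees.\<close>

locale hierarchy =
  fixes n :: nat and M :: "nat set set" and g :: "nat set \<Rightarrow> nat"
  assumes n: "2 \<le> n" and laminar: "laminar M" and subsets: "M \<subseteq> Pow {1..n} - {{}}"
    and top: "{1..n} \<in> M" and singletons: "\<And>i. i \<in> {1..n} \<Longrightarrow> {i} \<in> M"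
    and inj: "inj_on g M"
begin

definition parent :: "nat set \<Rightarrow> nat set" where
  "parent A = \<Inter>{D \<in> M. A \<subset> D}"

definition children :: "nat set \<Rightarrow> nat set set" where
  "children S = {A \<in> M - {{1..n}}. parent A = S}"

definition edge :: "nat set \<Rightarrow> nat set" where
  "edge A = {g A, g (parent A)}"

definition tree :: "nat rtree" where
  "tree = \<lparr>verts = g ` M, edges = edge ` (M - {{1..n}}), root_of = g {1..n}, leaf_of = (\<lambda>i. g {i})\<rparr>"

lemma tree_simps [simp]:
  "verts tree = g ` M" "edges tree = edge ` (M - {{1..n}})"
  "root_of tree = g {1..n}" "leaf_of tree i = g {i}"
  by (simp_all add: tree_def)

lemma finite_M: "finite M"
  using subsets finite_subset by blast

lemma member_finite: "A \<in> M \<Longrightarrow> finite A"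
  using subsets finite_subset[of A "{1..n}"] by blast

lemma subset_top: "A \<in> M \<Longrightarrow> A \<subseteq> {1..n}" and nonempty: "A \<in> M \<Longrightarrow> A \<noteq> {}"
  using subsets by blast+

lemma nested: "A \<in> M \<Longrightarrow> B \<in> M \<Longrightarrow> i \<in> A \<Longrightarrow> i \<in> B \<Longrightarrow> A \<subseteq> B \<or> B \<subseteq> A"
  using laminar unfolding laminar_def by (metis IntI emptyE)

text \<open>The members of a laminar family that contain a given nonempty set form a chain, so a least one
  exists.\<close>

lemma parent:
  assumes A: "A \<in> M" "A \<noteq> {1..n}"
  shows "parent A \<in> M" "A \<subset> parent A" "D \<in> M \<Longrightarrow> A \<subset> D \<Longrightarrow> parent A \<subseteq> D"
proof -
  define D where "D = arg_min card (\<lambda>D. D \<in> M \<and> A \<subset> D)"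
  have "{1..n} \<in> M \<and> A \<subset> {1..n}" using top subset_top[OF A(1)] A(2) by blast
  from arg_min_natI[of "\<lambda>D. D \<in> M \<and> A \<subset> D", OF this]
  have D: "D \<in> M" "A \<subset> D" unfolding D_def by blast+
  have least: "D \<subseteq> D'" if "D' \<in> M" "A \<subset> D'" for D'
  proof -
    have "card D \<le> card D'" unfolding D_def by (rule arg_min_nat_le) (use that in blast)
    moreover obtain i where "i \<in> A" using nonempty A(1) by blast
    then have "D \<subseteq> D' \<or> D' \<subseteq> D" using nested[OF D(1) that(1), of i] D(2) that(2) by blast
    ultimately show ?thesis using member_finite[OF D(1)] by (metis card_seteq order_refl)
  qed
  have "parent A = D" unfolding parent_def using D least by blast
  then show "parent A \<in> M" "A \<subset> parent A" "D' \<in> M \<Longrightarrow> A \<subset> D' \<Longrightarrow> parent A \<subseteq> D'" for D'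
    using D least by blast+
qed

lemma g_eq_iff: "A \<in> M \<Longrightarrow> B \<in> M \<Longrightarrow> g A = g B \<longleftrightarrow> A = B"
  using inj by (auto dest: inj_onD)

lemma edge_eq_iff:
  assumes "A \<in> M - {{1..n}}" "B \<in> M - {{1..n}}"
  shows "edge A = edge B \<longleftrightarrow> A = B"
proof
  assume "edge A = edge B"
  then have "A = B \<or> A = parent B \<and> parent A = B"
    using assms parent(1) unfolding edge_def by (auto simp: doubleton_eq_iff g_eq_iff)
  then show "A = B" using assms parent(2)[of A] parent(2)[of B] by blast
qed simp

lemma joined_top:
  assumes "D \<in> M" "\<And>D'. D' \<in> M - {{1..n}} \<Longrightarrow> D \<subseteq> D' \<Longrightarrow> edge D' \<notin> F"
  shows "joined (edges tree - F) (g D) (g {1..n})"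
  using assms
proof (induction "card ({1..n} - D)" arbitrary: D rule: less_induct)
  case less
  show ?case
  proof (cases "D = {1..n}")
    case False
    note p = parent[OF less.prems(1) False]
    have "{1..n} - parent D \<subset> {1..n} - D" using p(2) subset_top[OF p(1)] by blast
    then have "card ({1..n} - parent D) < card ({1..n} - D)" by (intro psubset_card_mono) simp
    then have "joined (edges tree - F) (g (parent D)) (g {1..n})"
    proof (rule less.hyps)
      show "edge D' \<notin> F" if "D' \<in> M - {{1..n}}" "parent D \<subseteq> D'" for D'
        using less.prems(2) that p(2) by blast
    qed (rule p(1))
    moreover have "joined (edges tree - F) (g D) (g (parent D))"
    proof (rule joined_edge)
      have "edge D \<in> edges tree - F" using less.prems False by simp
      then show "{g D, g (parent D)} \<in> edges tree - F" by (simp only: edge_def)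
    qed
    ultimately show ?thesis by (rule joined_trans[rotated])
  qed simp
qed

text \<open>The members contained in \<open>A\<close> can only be left through the edge above \<open>A\<close>, and climbing to the top from
  any other member avoids this edge.\<close>

lemma joined_minus_edge_iff:
  assumes A: "A \<in> M - {{1..n}}" and D: "D \<in> M"
  shows "joined (edges tree - {edge A}) (g D) (g {1..n}) \<longleftrightarrow> \<not> D \<subseteq> A"
proof
  assume "\<not> D \<subseteq> A"
  then show "joined (edges tree - {edge A}) (g D) (g {1..n})"
    by (intro joined_top[OF D]) (use edge_eq_iff A in blast)
next
  assume J: "joined (edges tree - {edge A}) (g D) (g {1..n})"
  show "\<not> D \<subseteq> A"
  proof
    assume "D \<subseteq> A"
    have "g {1..n} \<in> g ` {B \<in> M. B \<subseteq> A}"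
    proof (rule joined_closed[OF J])
      show "g D \<in> g ` {B \<in> M. B \<subseteq> A}" using D \<open>D \<subseteq> A\<close> by blast
      fix a b assume ab: "{a, b} \<in> edges tree - {edge A}" and "a \<in> g ` {B \<in> M. B \<subseteq> A}"
      then obtain B where B: "B \<in> M" "B \<subseteq> A" "a = g B" by blast
      from ab obtain E where E: "E \<in> M - {{1..n}}" "{a, b} = edge E" "E \<noteq> A" by auto
      then have p: "parent E \<in> M" "E \<subset> parent E" "A \<in> M" "E \<subset> A \<Longrightarrow> parent E \<subseteq> A"
        using parent[of E] A by blast+
      have "(B = E \<and> b = g (parent E)) \<or> (B = parent E \<and> b = g E)"
        using E B p(1) unfolding edge_def by (auto simp: doubleton_eq_iff g_eq_iff)
      then show "b \<in> g ` {B \<in> M. B \<subseteq> A}"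
      proof
        assume "B = E \<and> b = g (parent E)"
        moreover from this have "parent E \<subseteq> A" using p(4) B(2) E(3) by blast
        ultimately show ?thesis using p(1) by blast
      next
        assume "B = parent E \<and> b = g E"
        then show ?thesis using p(2) B(2) E(1) by blast
      qed
    qed
    then have "{1..n} \<subseteq> A" using g_eq_iff top by auto
    then show False using A subset_top by blast
  qed
qed

lemma tree_graph: "tree_graph tree"
  unfolding tree_graph_iff_bridge_tree bridge_tree_def
proof (intro conjI)
  show "finite (verts tree)" using finite_M by simp
  show "\<forall>e\<in>edges tree. \<exists>u\<in>verts tree. \<exists>v\<in>verts tree. e = {u, v}"
    using parent(1) by (auto simp: edge_def)
  have to_top: "joined (edges tree) (g A) (g {1..n})" if "A \<in> M" for A
    using joined_top[OF that, of "{}"] by simp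
  show "\<forall>u\<in>verts tree. \<forall>v\<in>verts tree. joined (edges tree) u v"
  proof (intro ballI)
    fix u v assume "u \<in> verts tree" "v \<in> verts tree"
    then obtain A B where "A \<in> M" "u = g A" "B \<in> M" "v = g B" by auto
    then show "joined (edges tree) u v"
      using joined_trans[OF to_top[of A] joined_sym[OF to_top[of B]]] by simp
  qed
  show "\<forall>u v. {u, v} \<in> edges tree \<longrightarrow> \<not> joined (edges tree - {{u, v}}) u v"
  proof (intro allI impI notI)
    fix u v assume "{u, v} \<in> edges tree" and J: "joined (edges tree - {{u, v}}) u v"
    then obtain A where A: "A \<in> M - {{1..n}}" "{u, v} = edge A" by auto
    have "joined (edges tree - {edge A}) (g A) (g (parent A))"
    proof (cases "u = g A")
      case True
      then have "v = g (parent A)" using A(2) unfolding edge_def by (auto simp: doubleton_eq_iff)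
      then show ?thesis using J A(2) True by simp
    next
      case False
      then have "u = g (parent A)" "v = g A" using A(2) unfolding edge_def by (auto simp: doubleton_eq_iff)
      then show ?thesis using joined_sym[OF J] A(2) by simp
    qed
    moreover have "joined (edges tree - {edge A}) (g (parent A)) (g {1..n})"
      using joined_minus_edge_iff[OF A(1), of "parent A"] parent[of A] A(1) by blast
    ultimately have "joined (edges tree - {edge A}) (g A) (g {1..n})" by (rule joined_trans)
    then show False using joined_minus_edge_iff[OF A(1), of A] A(1) by blast
  qed
qed

lemma children_subset: "A \<in> children S \<Longrightarrow> A \<in> M \<and> A \<subset> S"
  using parent(2) unfolding children_def by blast

lemma edges_at:
  assumes S: "S \<in> M"
  shows "{e \<in> edges tree. g S \<in> e} = edge ` (children S \<union> ({S} - {{1..n}}))"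
proof (intro equalityI subsetI)
  fix e assume "e \<in> {e \<in> edges tree. g S \<in> e}"
  then obtain A where A: "A \<in> M - {{1..n}}" "e = edge A" "g S \<in> edge A" by auto
  then have "S = A \<or> S = parent A" using S parent(1) g_eq_iff unfolding edge_def by auto
  then show "e \<in> edge ` (children S \<union> ({S} - {{1..n}}))" using A unfolding children_def by blast
next
  fix e assume "e \<in> edge ` (children S \<union> ({S} - {{1..n}}))"
  then show "e \<in> {e \<in> edges tree. g S \<in> e}" using S by (auto simp: children_def edge_def)
qed

lemma inj_on_edge: "inj_on edge (M - {{1..n}})"
  using edge_eq_iff by (meson inj_onI)

lemma degree_eq:
  assumes S: "S \<in> M"
  shows "degree tree (g S) = card (children S) + (if S = {1..n} then 0 else 1)"
proof -
  have "children S \<union> ({S} - {{1..n}}) \<subseteq> M - {{1..n}}" using S by (auto simp: children_def)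
  then have "degree tree (g S) = card (children S \<union> ({S} - {{1..n}}))"
    unfolding degree_def edges_at[OF S] by (intro card_image inj_on_subset[OF inj_on_edge])
  moreover have "S \<notin> children S" using children_subset by blast
  moreover have "finite (children S)" using finite_M by (simp add: children_def)
  ultimately show ?thesis by (simp add: insert_Diff_if)
qed

lemma child_containing:
  assumes S: "S \<in> M" "S \<noteq> {i}" and i: "i \<in> S"
  obtains A where "A \<in> children S" "i \<in> A"
proof -
  \<comment> \<open>A largest member below \<open>S\<close> that contains \<open>i\<close> has no room for another member above it.\<close>
  define A where "A = arg_max card (\<lambda>A. A \<in> M \<and> i \<in> A \<and> A \<subset> S)"
  have "{i} \<in> M \<and> i \<in> {i} \<and> {i} \<subset> S" using singletons i S subset_top by blast
  moreover have "\<forall>A. A \<in> M \<and> i \<in> A \<and> A \<subset> S \<longrightarrow> card A < Suc (card S)"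
    using card_mono member_finite[OF S(1)] by (meson le_imp_less_Suc psubset_imp_subset)
  ultimately have A: "A \<in> M \<and> i \<in> A \<and> A \<subset> S"
    and max: "\<And>B. B \<in> M \<and> i \<in> B \<and> B \<subset> S \<Longrightarrow> card B \<le> card A"
    unfolding A_def using arg_max_natI arg_max_nat_le
    by (metis (no_types, lifting))+
  have "A \<noteq> {1..n}" using A subset_top[OF S(1)] by blast
  note p = parent[OF conjunct1[OF A] this]
  have "parent A = S"
  proof (rule ccontr)
    assume "parent A \<noteq> S"
    then have "parent A \<subset> S" using p(3)[OF S(1)] A by blast
    then have "card (parent A) \<le> card A" using p A by (intro max) blast
    moreover have "card A < card (parent A)"
      using p(2) member_finite[OF p(1)] by (rule psubset_card_mono[rotated])
    ultimately show False by simp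
  qed
  then have "A \<in> children S" using A \<open>A \<noteq> {1..n}\<close> by (simp add: children_def)
  then show thesis using that A by blast
qed

lemma children_singleton: "children {i} = {}"
proof (rule equals0I)
  fix A assume "A \<in> children {i}"
  then show False using children_subset[of A "{i}"] nonempty[of A] by blast
qed

lemma card_children_ge:
  assumes S: "S \<in> M" "\<nexists>i. S = {i}"
  shows "2 \<le> card (children S)"
proof -
  obtain i where i: "i \<in> S" using nonempty[OF S(1)] by blast
  then obtain A where A: "A \<in> children S" "i \<in> A" using child_containing S by metis
  then obtain j where j: "j \<in> S" "j \<notin> A" using children_subset by blast
  then obtain B where B: "B \<in> children S" "j \<in> B" using child_containing S by metis
  have "A \<noteq> B" using j B by blast
  moreover have "finite (children S)" using finite_M by (simp add: children_def)
  ultimately show ?thesis using card_mono[of "children S" "{A, B}"] A B by simp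
qed

lemma singleton_ne_top: "{i} \<noteq> {1..n}"
proof
  assume "{i} = {1..n}"
  then have "card {i} = card {1..n}" by simp
  then show False using n by simp
qed

lemma leaf_iff: "S \<in> M \<Longrightarrow> degree tree (g S) = 1 \<longleftrightarrow> (\<exists>i. S = {i})"
proof
  assume "S \<in> M" "degree tree (g S) = 1"
  then show "\<exists>i. S = {i}" using card_children_ge[of S] by (auto simp: degree_eq)
next
  assume "S \<in> M" "\<exists>i. S = {i}"
  then show "degree tree (g S) = 1" using singleton_ne_top by (auto simp: degree_eq children_singleton)
qed

lemma leaves_tree: "leaves tree = (\<lambda>i. g {i}) ` {1..n}"
proof (intro equalityI subsetI)
  fix v assume "v \<in> leaves tree"
  then obtain S where S: "S \<in> M" "v = g S" "degree tree (g S) = 1" by (auto simp: leaves_def)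
  then obtain i where "S = {i}" using leaf_iff by blast
  then show "v \<in> (\<lambda>i. g {i}) ` {1..n}" using S subset_top by blast
next
  fix v assume "v \<in> (\<lambda>i. g {i}) ` {1..n}"
  then obtain i where "i \<in> {1..n}" "v = g {i}" by blast
  then show "v \<in> leaves tree" using singletons[of i] leaf_iff[of "{i}"] by (simp add: leaves_def)
qed

lemma labelled_tree: "labelled_tree n tree"
  unfolding labelled_tree_def
proof (intro conjI)
  show "tree_graph tree" by (rule tree_graph)
  show "root_of tree \<in> verts tree" using top by simp
  have "\<nexists>i. {1..n} = {i}" using singleton_ne_top by metis
  then show "1 < degree tree (root_of tree)"
    using card_children_ge[OF top] degree_eq[OF top] by simp
  show "\<forall>v\<in>verts tree - leaves tree - {root_of tree}. 3 \<le> degree tree v"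
  proof
    fix v assume v: "v \<in> verts tree - leaves tree - {root_of tree}"
    then obtain S where S: "S \<in> M" "v = g S" by auto
    with v have "degree tree (g S) \<noteq> 1" "S \<noteq> {1..n}" by (auto simp: leaves_def)
    then have "\<nexists>i. S = {i}" "S \<noteq> {1..n}" using leaf_iff[OF S(1)] by blast+
    then show "3 \<le> degree tree v" using S card_children_ge degree_eq by simp
  qed
  have "i = j" if "i \<in> {1..n}" "j \<in> {1..n}" "g {i} = g {j}" for i j
    using that singletons g_eq_iff by blast
  then show "bij_betw (leaf_of tree) {1..n} (leaves tree)"
    unfolding leaves_tree bij_betw_def by (auto intro!: inj_onI)
qed

lemma cluster_edge:
  assumes "A \<in> M - {{1..n}}"
  shows "cluster n tree (edge A) = A"
proof -
  have "\<not> joined (edges tree - {edge A}) (g {i}) (g {1..n}) \<longleftrightarrow> i \<in> A" if "i \<in> {1..n}" for i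
    using joined_minus_edge_iff[OF assms singletons[OF that]] by simp
  then show ?thesis
    using subset_top[of A] assms unfolding cluster_def tree_simps(3,4) by blast
qed

lemma internal_edges_tree: "internal_edges tree = edge ` {A \<in> M. A \<noteq> {1..n} \<and> (\<nexists>i. A = {i})}"
proof -
  have "edge A \<inter> leaves tree = {} \<longleftrightarrow> (\<nexists>i. A = {i})" if A: "A \<in> M - {{1..n}}" for A
  proof -
    have p: "parent A \<in> M" "A \<subset> parent A" using parent A by blast+
    have "\<nexists>i. parent A = {i}" using p(2) nonempty[of A] A by (auto dest: subset_singletonD)
    then have "g (parent A) \<notin> leaves tree"
      using leaf_iff[OF p(1)] by (simp add: leaves_def)
    moreover have "g A \<in> leaves tree \<longleftrightarrow> (\<exists>i. A = {i})"
      using leaf_iff[of A] A by (auto simp: leaves_def)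
    ultimately show ?thesis unfolding edge_def by auto
  qed
  then have "{A \<in> M - {{1..n}}. edge A \<inter> leaves tree = {}} = {A \<in> M. A \<noteq> {1..n} \<and> (\<nexists>i. A = {i})}"
    by (intro Collect_cong) auto
  moreover have "internal_edges tree = edge ` {A \<in> M - {{1..n}}. edge A \<inter> leaves tree = {}}"
    unfolding internal_edges_def tree_simps by (rule Compr_image_eq)
  ultimately show ?thesis by simp
qed

text \<open>A path to the root that uses an edge at its starting vertex must leave along this edge, so an
  edge leads down exactly if its removal does not cut off the vertex from the root.\<close>

lemma outdegree_eq:
  assumes S: "S \<in> M"
  shows "outdegree tree (g S) = card (children S)"
proof -
  let ?down = "\<lambda>e. \<forall>p. path_between (edges tree) (g S) p (g {1..n}) \<longrightarrow> e \<notin> path_edges p"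
  have down: "?down (edge A)" if A: "A \<in> children S" for A
  proof (intro allI impI notI)
    fix p assume p: "path_between (edges tree) (g S) p (g {1..n})" "edge A \<in> path_edges p"
    have A': "A \<in> M - {{1..n}}" "edge A = {g S, g A}" using A by (auto simp: children_def edge_def)
    then have "joined (edges tree - {edge A}) (g A) (g {1..n})" using path_first_edge p by metis
    then show False using joined_minus_edge_iff[OF A'(1), of A] A'(1) by blast
  qed
  have up: "\<not> ?down (edge S)" if "S \<noteq> {1..n}"
  proof
    assume *: "?down (edge S)"
    obtain p where p: "path_between (edges tree) (g S) p (g {1..n})"
      using joined_top[OF S, of "{}"] unfolding joined_iff_path by auto
    with * have "path_between (edges tree - {edge S}) (g S) p (g {1..n})"
      by (auto simp: path_between_def)
    then have "joined (edges tree - {edge S}) (g S) (g {1..n})" by (rule path_imp_joined)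
    then show False using joined_minus_edge_iff[of S S] S that by blast
  qed
  have "{e \<in> edges tree. g S \<in> e \<and> ?down e} = {e \<in> edge ` (children S \<union> ({S} - {{1..n}})). ?down e}"
    using edges_at[OF S] by blast
  also have "\<dots> = edge ` children S"
    using down up by blast
  finally have "outdegree tree (g S) = card (edge ` children S)" by (simp add: outdegree_def)
  also have "\<dots> = card (children S)"
    by (rule card_image, rule inj_on_subset[OF inj_on_edge]) (auto simp: children_def)
  finally show ?thesis .
qed

text \<open>If \<open>S\<close> is the disjoint union of two members, then every other member below \<open>S\<close> is contained in one
  of them: a member that meets both without being contained in either contains both. Hence the two
  parts are the children of \<open>S\<close>.\<close>

lemma binary_tree:
  assumes split: "\<And>S. S \<in> M \<Longrightarrow> (\<nexists>i. S = {i}) \<Longrightarrow> \<exists>A\<in>M. \<exists>B\<in>M. S = A \<union> B \<and> A \<inter> B = {}"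
  shows "binary_tree n tree"
  unfolding binary_tree_def
proof (intro conjI ballI)
  fix v assume "v \<in> verts tree - leaves tree"
  then obtain S where S: "S \<in> M" "v = g S" "degree tree (g S) \<noteq> 1" by (auto simp: leaves_def)
  then have not_single: "\<nexists>i. S = {i}" using leaf_iff by blast
  with split[OF S(1)] obtain A B where AB: "A \<in> M" "B \<in> M" "S = A \<union> B" "A \<inter> B = {}" by blast
  then have proper: "A \<subset> S" "B \<subset> S" using nonempty by blast+
  have "D = A \<or> D = B" if D: "D \<in> children S" for D
  proof -
    have D': "D \<in> M" "D \<noteq> {1..n}" "parent D = S" "D \<subset> S"
      using D children_subset[OF D] by (simp_all add: children_def)
    have least: "\<not> D \<subset> A" "\<not> D \<subset> B"
      using parent(3)[OF D'(1,2)] D'(3) AB(1,2) proper by blast+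
    obtain i where i: "i \<in> D" using nonempty[OF D'(1)] by blast
    then have "i \<in> A \<or> i \<in> B" using D'(4) AB(3) by blast
    then have "D \<subseteq> A \<or> A \<subseteq> D \<or> D \<subseteq> B \<or> B \<subseteq> D"
      using nested[OF D'(1) AB(1) i] nested[OF D'(1) AB(2) i] by blast
    moreover have "\<not> A \<subset> D" "\<not> B \<subset> D"
    proof -
      have sub: "D \<subseteq> B \<or> B \<subseteq> D" if AD: "A \<subset> D"
      proof -
        obtain j where "j \<in> D" "j \<in> B" using AD D'(4) AB(3) by blast
        then show ?thesis using nested[OF D'(1) AB(2)] by blast
      qed
      have sub': "D \<subseteq> A \<or> A \<subseteq> D" if BD: "B \<subset> D"
      proof -
        obtain j where "j \<in> D" "j \<in> A" using BD D'(4) AB(3) by blast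
        then show ?thesis using nested[OF D'(1) AB(1)] by blast
      qed
      show "\<not> A \<subset> D" using sub D'(4) AB nonempty by blast
      show "\<not> B \<subset> D" using sub' D'(4) AB nonempty by blast
    qed
    ultimately show ?thesis using least by blast
  qed
  then have "card (children S) \<le> card {A, B}" by (intro card_mono) auto
  also have "\<dots> \<le> 2" by (simp add: card_insert_if)
  finally have "card (children S) = 2" using card_children_ge[OF S(1) not_single] by simp
  then show "outdegree tree v = 2" using outdegree_eq S by simp
qed (rule labelled_tree)

end

section \<open>The complex of trees as a complex of laminar families\<close>

definition binary_extension :: "'a set \<Rightarrow> 'a set set \<Rightarrow> 'a set set \<Rightarrow> bool" where
  "binary_extension X F M \<longleftrightarrow>
     F \<subseteq> M \<and> laminar M \<and> M \<subseteq> Pow X - {{}} \<and> X \<in> M \<and> (\<forall>i\<in>X. {i} \<in> M) \<and>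
     (\<forall>S\<in>M. (\<nexists>i. S = {i}) \<longrightarrow> (\<exists>A\<in>M. \<exists>B\<in>M. S = A \<union> B \<and> A \<inter> B = {}))"

lemma binary_extensionD:
  assumes "binary_extension X F M"
  shows "F \<subseteq> M" "laminar M" "M \<subseteq> Pow X - {{}}" "X \<in> M" "\<forall>i\<in>X. {i} \<in> M"
    "\<forall>S\<in>M. (\<nexists>i. S = {i}) \<longrightarrow> (\<exists>A\<in>M. \<exists>B\<in>M. S = A \<union> B \<and> A \<inter> B = {})"
  using assms unfolding binary_extension_def by - (elim conjE, assumption)+

text \<open>A maximal proper member \<open>A\<close> of the family is nested with or disjoint from all others, so the
  family splits along \<open>A\<close> and its complement.\<close>

lemma laminar_extends_to_binary:
  assumes "finite X" "X \<noteq> {}" "laminar F" "F \<subseteq> Pow X - {{}}"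
  shows "\<exists>M. binary_extension X F M"
  using assms
proof (induction "card X" arbitrary: X F rule: less_induct)
  case less
  note fin = less.prems(1)
  show ?case
  proof (cases "\<exists>i. X = {i}")
    case True
    then have "F \<subseteq> {X}" using less.prems(4) by (auto simp: subset_singleton_iff)
    with True show ?thesis
      by (intro exI[of _ "{X}"]) (auto simp: laminar_def binary_extension_def)
  next
    case False
    have "\<exists>A. A \<noteq> {} \<and> A \<subset> X \<and> (\<forall>S\<in>F. S = X \<or> S \<subseteq> A \<or> S \<inter> A = {})"
    proof (cases "F \<subseteq> {X}")
      case True
      obtain i where "i \<in> X" using less.prems(2) by blast
      with True \<open>\<nexists>i. X = {i}\<close> show ?thesis by (intro exI[of _ "{i}"]) blast
    next
      case False
      have "finite (F - {X})" using fin less.prems(4) by (meson finite_Diff finite_Pow_iff finite_subset)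
      then obtain A where A: "A \<in> F - {X}" "\<forall>S\<in>F - {X}. A \<subseteq> S \<longrightarrow> A = S"
        using finite_has_maximal[of "F - {X}"] False by blast
      have "S = X \<or> S \<subseteq> A \<or> S \<inter> A = {}" if "S \<in> F" for S
        using A less.prems(3) that unfolding laminar_def by (metis DiffD1 DiffI order_refl singletonD)
      moreover have "A \<noteq> {}" "A \<subset> X" using A(1) less.prems(4) by blast+
      ultimately show ?thesis by blast
    qed
    then obtain A where A: "A \<noteq> {}" "A \<subset> X" "\<forall>S\<in>F. S = X \<or> S \<subseteq> A \<or> S \<inter> A = {}"
      by (elim exE conjE) (rule that)
    define B where "B = X - A"
    have B: "B \<noteq> {}" "B \<subset> X" "A \<union> B = X" "A \<inter> B = {}" using A(1,2) unfolding B_def by blast+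
    have IH: "\<exists>M. binary_extension Y (F \<inter> Pow Y) M" if "Y \<noteq> {}" "Y \<subset> X" for Y
    proof (rule less.hyps)
      show "card Y < card X" using that(2) fin by (rule psubset_card_mono[rotated])
      show "finite Y" using that(2) fin finite_subset by blast
      show "laminar (F \<inter> Pow Y)" using less.prems(3) unfolding laminar_def by blast
      show "F \<inter> Pow Y \<subseteq> Pow Y - {{}}" using less.prems(4) by blast
    qed (rule that(1))
    obtain MA where "binary_extension A (F \<inter> Pow A) MA" using IH[OF A(1,2)] by blast
    note MA = binary_extensionD[OF this]
    obtain MB where "binary_extension B (F \<inter> Pow B) MB" using IH[OF B(1,2)] by blast
    note MB = binary_extensionD[OF this]
    show ?thesis
      unfolding binary_extension_def
    proof (intro exI[of _ "insert X (MA \<union> MB)"] conjI ballI impI)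
      show "F \<subseteq> insert X (MA \<union> MB)"
      proof
        fix S assume "S \<in> F"
        moreover from this less.prems(4) have "S \<subseteq> X" by blast
        ultimately have "S = X \<or> S \<in> F \<inter> Pow A \<or> S \<in> F \<inter> Pow B" using bspec[OF A(3), of S] unfolding B_def by blast
        then show "S \<in> insert X (MA \<union> MB)" using MA(1) MB(1) by blast
      qed
      have bounds: "S \<in> MA \<Longrightarrow> S \<subseteq> A" "S \<in> MB \<Longrightarrow> S \<subseteq> B" for S using MA(3) MB(3) by blast+
      show "laminar (insert X (MA \<union> MB))"
        unfolding laminar_def
      proof (intro ballI)
        fix S T assume ST: "S \<in> insert X (MA \<union> MB)" "T \<in> insert X (MA \<union> MB)"
        then have "S \<subseteq> X" "T \<subseteq> X" using bounds A(2) B(2) by blast+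
        moreover have "S \<inter> T = {} \<or> S \<subseteq> T \<or> T \<subseteq> S" if "S \<in> MA" "T \<in> MA"
          using MA(2) that unfolding laminar_def by blast
        moreover have "S \<inter> T = {} \<or> S \<subseteq> T \<or> T \<subseteq> S" if "S \<in> MB" "T \<in> MB"
          using MB(2) that unfolding laminar_def by blast
        moreover have "S \<inter> T = {}" if "S \<in> MA \<and> T \<in> MB \<or> S \<in> MB \<and> T \<in> MA"
          using bounds that B(4) by blast
        ultimately show "S \<inter> T = {} \<or> S \<subseteq> T \<or> T \<subseteq> S" using ST by blast
      qed
      show "insert X (MA \<union> MB) \<subseteq> Pow X - {{}}"
        using MA(3) MB(3) A(2) B(2) less.prems(2) by blast
      show "{i} \<in> insert X (MA \<union> MB)" if "i \<in> X" for i
        using that MA(5) MB(5) B(3) by blast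
      fix S assume S: "S \<in> insert X (MA \<union> MB)" "\<nexists>i. S = {i}"
      show "\<exists>A\<in>insert X (MA \<union> MB). \<exists>B\<in>insert X (MA \<union> MB). S = A \<union> B \<and> A \<inter> B = {}"
      proof (cases "S = X")
        case True
        then show ?thesis using MA(4) MB(4) B(3,4) by blast
      next
        case False
        then consider "S \<in> MA" | "S \<in> MB" using S(1) by blast
        then show ?thesis
        proof cases
          case 1
          with MA(6) S(2) obtain C D where "C \<in> MA" "D \<in> MA" "S = C \<union> D" "C \<inter> D = {}" by blast
          then show ?thesis by blast
        next
          case 2
          with MB(6) S(2) obtain C D where "C \<in> MB" "D \<in> MB" "S = C \<union> D" "C \<inter> D = {}" by blast
          then show ?thesis by blast
        qed
      qed
    qed simp
  qed
qed

definition proper_clusters :: "nat \<Rightarrow> nat set set" where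
  "proper_clusters n = {S. S \<subseteq> {1..n} \<and> 2 \<le> card S \<and> card S < n}"

definition laminar_complex :: "nat \<Rightarrow> nat set set set" where
  "laminar_complex n = {F. F \<subseteq> proper_clusters n \<and> laminar F}"

lemma laminar_family_is_clusters_of_binary_tree:
  assumes F: "F \<in> laminar_complex n" and n: "2 \<le> n"
  shows "\<exists>B :: nat rtree. binary_tree n B \<and> F \<subseteq> cluster n B ` internal_edges B"
proof -
  have F': "F \<subseteq> proper_clusters n" "laminar F" using F by (auto simp: laminar_complex_def)
  have "F \<subseteq> Pow {1..n} - {{}}" using F'(1) by (auto simp: proper_clusters_def)
  from laminar_extends_to_binary[OF _ _ F'(2) this] n
  obtain M where "binary_extension {1..n} F M" by auto
  note M = binary_extensionD[OF this]
  have "finite M" using M(3) finite_subset by blast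
  then obtain g :: "nat set \<Rightarrow> nat" where "inj_on g M" using finite_imp_inj_to_nat_seg by blast
  then interpret hierarchy n M g using M n by unfold_locales auto
  have "binary_tree n tree" using M(6) by (intro binary_tree) blast
  moreover have "S \<in> cluster n tree ` internal_edges tree" if "S \<in> F" for S
  proof -
    have "S \<in> proper_clusters n" using that F'(1) by blast
    then have "S \<noteq> {1..n}" "\<nexists>i. S = {i}" by (auto simp: proper_clusters_def)
    then have "edge S \<in> internal_edges tree" "cluster n tree (edge S) = S"
      using that M(1) cluster_edge[of S] unfolding internal_edges_tree by blast+
    then show ?thesis by (metis imageI)
  qed
  ultimately show ?thesis by blast
qed

text \<open>The tree of the laminar family that consists of \<open>S\<close>, the top and the singletons has the required
  shape.\<close>

lemma spider_type_nonempty: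
  assumes S: "S \<in> proper_clusters n"
  shows "spider_type n S \<noteq> {}"
proof -
  let ?M = "{{1..n}, S} \<union> (\<lambda>i. {i}) ` {1..n}"
  have S': "S \<subseteq> {1..n}" "S \<noteq> {1..n}" "\<nexists>i. S = {i}" "S \<noteq> {}" "2 \<le> n"
    using S by (auto simp: proper_clusters_def)
  have "finite ?M" by simp
  then obtain g :: "nat set \<Rightarrow> nat" where g: "inj_on g ?M" using finite_imp_inj_to_nat_seg by blast
  interpret hierarchy n ?M g
  proof
    show "laminar ?M" unfolding laminar_def using S'(1) by auto
    show "?M \<subseteq> Pow {1..n} - {{}}" using S' by auto
  qed (use S'(5) g in auto)
  have "{A \<in> ?M. A \<noteq> {1..n} \<and> (\<nexists>i. A = {i})} = {S}" using S'(2,3) by auto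
  then have single: "internal_edges tree = {edge S}" unfolding internal_edges_tree by simp
  have "cluster n tree (edge S) = S" using cluster_edge[of S] S'(2) by simp
  with single_internal_edge_imp_spider[OF labelled_tree_imp_leaf_labelled[OF labelled_tree] single]
  have "tree \<in> spider_type n S" using labelled_tree by (simp add: spider_type_def)
  then show ?thesis by blast
qed

lemma inj_on_spider_type: "inj_on (spider_type n) (proper_clusters n)"
proof (rule inj_onI)
  fix S S' assume S: "S \<in> proper_clusters n" "S' \<in> proper_clusters n" "spider_type n S = spider_type n S'"
  then obtain T :: "nat rtree" where "spider n S T" "spider n S' T"
    using spider_type_nonempty[OF S(1)] unfolding spider_type_def by blast
  then show "S = S'"
    using S(1,2) by (intro spider_determines_cluster) (auto simp: proper_clusters_def)
qed

lemma tree_complex_eq: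
  assumes n: "2 \<le> n"
  shows "tree_complex n = (`) (spider_type n) ` laminar_complex n"
proof (intro equalityI subsetI)
  fix \<sigma> assume "\<sigma> \<in> tree_complex n"
  then obtain B :: "nat rtree" and C where B: "binary_tree n B" "C \<subseteq> internal_edges B"
    and \<sigma>: "\<sigma> = tree_simplex n (contract B C)"
    unfolding tree_complex_def by blast
  have L: "labelled_tree n B" using B(1) by (simp add: binary_tree_def)
  note LL = labelled_tree_imp_leaf_labelled[OF L]
  let ?F = "cluster n B ` (internal_edges B - C)"
  have "cluster n B e \<in> proper_clusters n" if "e \<in> internal_edges B" for e
    using cluster_size[OF L that] by (auto simp: proper_clusters_def cluster_def)
  moreover have "laminar ?F"
    using clusters_laminar[OF LL] unfolding laminar_def internal_edges_def by blast
  ultimately have "?F \<in> laminar_complex n" unfolding laminar_complex_def by blast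
  then show "\<sigma> \<in> (`) (spider_type n) ` laminar_complex n"
    unfolding \<sigma> tree_simplex_contract[OF LL B(2)] by (rule imageI)
next
  fix \<sigma> assume "\<sigma> \<in> (`) (spider_type n) ` laminar_complex n"
  then obtain F where F: "F \<in> laminar_complex n" "\<sigma> = spider_type n ` F" by blast
  obtain B :: "nat rtree" where B: "binary_tree n B" "F \<subseteq> cluster n B ` internal_edges B"
    using laminar_family_is_clusters_of_binary_tree[OF F(1) n] by blast
  let ?C = "{e \<in> internal_edges B. cluster n B e \<notin> F}"
  have LL: "leaf_labelled n B"
    using B(1) by (intro labelled_tree_imp_leaf_labelled) (simp add: binary_tree_def)
  have C: "?C \<subseteq> internal_edges B" by blast
  have "cluster n B ` (internal_edges B - ?C) = F" using B(2) by blast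
  then have "tree_simplex n (contract B ?C) = \<sigma>"
    using tree_simplex_contract[OF LL C] F(2) by simp
  then show "\<sigma> \<in> tree_complex n" using B(1) C unfolding tree_complex_def by blast
qed

section \<open>From laminar families to chains of partitions\<close>

text \<open>A partition is represented by its blocks with at least two elements. The joins of disjoint
  clusters are then simply the sets of these clusters, and the partitions with a single nontrivial
  block are the singletons \<open>{S}\<close>.\<close>

definition proper_blocks :: "nat \<Rightarrow> nat set set set" where
  "proper_blocks n =
     {p. p \<noteq> {} \<and> p \<noteq> {{1..n}} \<and> disjoint p \<and> (\<forall>S\<in>p. S \<subseteq> {1..n} \<and> 2 \<le> card S)}"

definition composites :: "nat \<Rightarrow> nat set set set" where
  "composites n = {p \<in> proper_blocks n. 2 \<le> card p}"

definition below :: "'a set set \<Rightarrow> 'a set set \<Rightarrow> bool" where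
  "below p q \<longleftrightarrow> (\<forall>S\<in>p. \<exists>T\<in>q. S \<subseteq> T)"

definition clusters_in :: "'a set set set \<Rightarrow> 'a set set" where
  "clusters_in \<sigma> = {S. {S} \<in> \<sigma>}"

text \<open>If \<open>U\<close> contains all composites above its members, then the partitions with one nontrivial block,
  the members of \<open>U\<close> and the top of the partition lattice form a building set, and these are its nested
  sets. An antichain of at least two elements must not have its join in the building set; for antichains
  with a member of \<open>U\<close> the join always lies there, which leaves the comparability condition.\<close>

definition nested_complex :: "nat \<Rightarrow> nat set set set \<Rightarrow> nat set set set set" where
  "nested_complex n U =
     {\<sigma>. \<sigma> \<subseteq> (\<lambda>S. {S}) ` proper_clusters n \<union> U \<and>
         (\<forall>u\<in>\<sigma> \<inter> U. \<forall>v\<in>\<sigma>. below u v \<or> below v u) \<and>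
         laminar (clusters_in \<sigma>) \<and>
         (\<forall>A. A \<subseteq> clusters_in \<sigma> \<longrightarrow> disjoint A \<longrightarrow> 2 \<le> card A \<longrightarrow> A \<notin> U)}"

lemma nested_complexD:
  assumes "\<sigma> \<in> nested_complex n U"
  shows "\<sigma> \<subseteq> (\<lambda>S. {S}) ` proper_clusters n \<union> U"
    "u \<in> \<sigma> \<Longrightarrow> u \<in> U \<Longrightarrow> v \<in> \<sigma> \<Longrightarrow> below u v \<or> below v u"
    "laminar (clusters_in \<sigma>)"
    "A \<subseteq> clusters_in \<sigma> \<Longrightarrow> disjoint A \<Longrightarrow> 2 \<le> card A \<Longrightarrow> A \<notin> U"
  using assms unfolding nested_complex_def by simp_all

lemma nested_complexI:
  assumes "\<sigma> \<subseteq> (\<lambda>S. {S}) ` proper_clusters n \<union> U"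
    "\<And>u v. u \<in> \<sigma> \<Longrightarrow> u \<in> U \<Longrightarrow> v \<in> \<sigma> \<Longrightarrow> below u v \<or> below v u"
    "laminar (clusters_in \<sigma>)"
    "\<And>A. A \<subseteq> clusters_in \<sigma> \<Longrightarrow> disjoint A \<Longrightarrow> 2 \<le> card A \<Longrightarrow> A \<notin> U"
  shows "\<sigma> \<in> nested_complex n U"
  using assms unfolding nested_complex_def by simp

lemma nested_complex_subset:
  assumes "\<sigma> \<in> nested_complex n U" "\<tau> \<subseteq> \<sigma>"
  shows "\<tau> \<in> nested_complex n U"
proof (rule nested_complexI)
  note D = nested_complexD[OF assms(1)]
  have sub: "clusters_in \<tau> \<subseteq> clusters_in \<sigma>" using assms(2) by (auto simp: clusters_in_def)
  show "\<tau> \<subseteq> (\<lambda>S. {S}) ` proper_clusters n \<union> U" using D(1) assms(2) by (rule subset_trans[rotated])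
  show "below u v \<or> below v u" if "u \<in> \<tau>" "u \<in> U" "v \<in> \<tau>" for u v
    using D(2) that assms(2) by (meson subsetD)
  show "laminar (clusters_in \<tau>)" using D(3) sub unfolding laminar_def by (meson subsetD)
  show "A \<notin> U" if "A \<subseteq> clusters_in \<tau>" "disjoint A" "2 \<le> card A" for A
    using D(4) that sub by (meson subset_trans)
qed

lemma below_refl: "below p p"
  by (auto simp: below_def)

lemma below_trans: "below p q \<Longrightarrow> below q r \<Longrightarrow> below p r"
  unfolding below_def by (meson subset_trans)

lemma proper_clustersD:
  assumes "S \<in> proper_clusters n"
  shows "S \<subseteq> {1..n}" "2 \<le> card S" "S \<noteq> {}" "S \<noteq> {1..n}"
  using assms by (auto simp: proper_clusters_def)

lemma proper_blocksD:
  assumes "p \<in> proper_blocks n"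
  shows "p \<noteq> {}" "p \<noteq> {{1..n}}" "finite p" "S \<in> p \<Longrightarrow> S \<subseteq> {1..n}" "S \<in> p \<Longrightarrow> 2 \<le> card S"
    "S \<in> p \<Longrightarrow> S \<noteq> {}" "S \<in> p \<Longrightarrow> T \<in> p \<Longrightarrow> S \<inter> T \<noteq> {} \<Longrightarrow> S = T"
proof -
  have p: "p \<noteq> {}" "p \<noteq> {{1..n}}" "disjoint p" "\<And>S. S \<in> p \<Longrightarrow> S \<subseteq> {1..n} \<and> 2 \<le> card S"
    using assms by (simp_all add: proper_blocks_def)
  show "p \<noteq> {}" "p \<noteq> {{1..n}}" by (fact p)+
  have "p \<subseteq> Pow {1..n}" using p(4) by blast
  then show "finite p" by (rule finite_subset) simp
  show "S \<in> p \<Longrightarrow> S \<subseteq> {1..n}" "S \<in> p \<Longrightarrow> 2 \<le> card S" using p(4) by blast+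
  show "S \<in> p \<Longrightarrow> S \<noteq> {}" using p(4)[of S] by auto
  show "S \<in> p \<Longrightarrow> T \<in> p \<Longrightarrow> S \<inter> T \<noteq> {} \<Longrightarrow> S = T"
    using p(3) unfolding pairwise_def disjnt_def by meson
qed

lemma below_antisym:
  assumes p: "p \<in> proper_blocks n" and q: "q \<in> proper_blocks n" and le: "below p q" "below q p"
  shows "p = q"
proof -
  have sub: "p \<subseteq> q" if p: "p \<in> proper_blocks n" and le: "below p q" "below q p" for p q
  proof
    fix S assume S: "S \<in> p"
    then obtain T where T: "T \<in> q" "S \<subseteq> T" using le(1) unfolding below_def by meson
    then obtain S' where S': "S' \<in> p" "T \<subseteq> S'" using le(2) unfolding below_def by meson
    have "S = S'"
      using proper_blocksD(7)[OF p S S'(1)] proper_blocksD(6)[OF p S] T(2) S'(2) by blast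
    then have "T = S" using T(2) S'(2) by blast
    then show "S \<in> q" using T(1) by simp
  qed
  show ?thesis using sub[OF p le] sub[OF q le(2,1)] by (rule equalityI)
qed

lemma singleton_not_composite: "{S} \<notin> composites n"
  by (simp add: composites_def)

lemma composite_blocks:
  assumes "p \<in> composites n" "S \<in> p"
  shows "S \<in> proper_clusters n"
proof -
  have p: "p \<in> proper_blocks n" "2 \<le> card p" using assms(1) by (simp_all add: composites_def)
  note D = proper_blocksD[OF p(1)]
  have "S \<noteq> {1..n}"
  proof
    assume "S = {1..n}"
    have "T = S" if "T \<in> p" for T
      using D(7)[OF that assms(2)] D(4,6)[OF that] \<open>S = {1..n}\<close> by blast
    then have "p \<subseteq> {S}" by blast
    then have "card p \<le> 1" using card_mono[of "{S}" p] by simp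
    then show False using p(2) by simp
  qed
  then have "S \<subset> {1..n}" using D(4)[OF assms(2)] by blast
  then have "card S < n" using psubset_card_mono[of "{1..n}" S] by simp
  then show ?thesis using D(4,5)[OF assms(2)] by (simp add: proper_clusters_def)
qed

lemma disjoint_clusters_composite:
  assumes "A \<subseteq> proper_clusters n" "disjoint A" "2 \<le> card A"
  shows "A \<in> composites n"
proof -
  have "A \<noteq> {}" "A \<noteq> {{1..n}}" using assms(3) by auto
  moreover have "S \<subseteq> {1..n} \<and> 2 \<le> card S" if "S \<in> A" for S
    using assms(1) that proper_clustersD(1,2) by blast
  ultimately show ?thesis using assms(2,3) by (simp add: composites_def proper_blocks_def)
qed

context
  fixes n :: nat and U :: "nat set set set" and x :: "nat set set"
  assumes U: "U \<subseteq> composites n" and x: "x \<in> composites n" "x \<notin> U"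
    and up: "\<And>u v. u \<in> U \<Longrightarrow> v \<in> composites n \<Longrightarrow> below u v \<Longrightarrow> v \<in> U"
    and above_x: "\<And>v. v \<in> composites n \<Longrightarrow> below x v \<Longrightarrow> v = x \<or> v \<in> U"
begin

abbreviation (input) factors :: "nat set set set" where
  "factors \<equiv> (\<lambda>S. {S}) ` x"

private lemma x_blocks: "x \<in> proper_blocks n" "disjoint x" "2 \<le> card x"
  using x(1) by (simp_all add: composites_def proper_blocks_def)

private lemma x_not_below: "u \<in> U \<Longrightarrow> \<not> below u x"
  using up[OF _ x(1)] x(2) by blast

private lemma clusters_in_insert: "clusters_in (insert x \<tau>) = clusters_in \<tau>"
  using singleton_not_composite x(1) by (auto simp: clusters_in_def)

private lemma clusters_in_factors: "clusters_in (\<tau> \<union> factors) = clusters_in \<tau> \<union> x"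
  by (auto simp: clusters_in_def)

private lemma factors_subset_iff: "factors \<subseteq> \<sigma> \<longleftrightarrow> x \<subseteq> clusters_in \<sigma>"
  by (auto simp: clusters_in_def)

private lemma clusters_in_proper:
  assumes "\<sigma> \<subseteq> (\<lambda>S. {S}) ` proper_clusters n \<union> insert x U"
  shows "clusters_in \<sigma> \<subseteq> proper_clusters n"
proof
  fix S assume "S \<in> clusters_in \<sigma>"
  then have "{S} \<in> (\<lambda>S. {S}) ` proper_clusters n \<union> insert x U"
    using assms by (auto simp: clusters_in_def)
  moreover have "{S} \<notin> insert x U" using U x(1) singleton_not_composite by blast
  ultimately show "S \<in> proper_clusters n" by blast
qed

text \<open>The blocks of \<open>x\<close> are the only disjoint clusters whose join is \<open>x\<close>.\<close>

lemma nested_complex_insert_without: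
  assumes "x \<notin> \<sigma>"
  shows "\<sigma> \<in> nested_complex n (insert x U) \<longleftrightarrow> \<sigma> \<in> nested_complex n U \<and> \<not> factors \<subseteq> \<sigma>"
proof (intro iffI conjI)
  assume \<sigma>: "\<sigma> \<in> nested_complex n (insert x U)"
  note D = nested_complexD[OF \<sigma>]
  show "\<not> factors \<subseteq> \<sigma>" using D(4)[OF _ x_blocks(2,3)] factors_subset_iff by blast
  show "\<sigma> \<in> nested_complex n U"
  proof (rule nested_complexI)
    show "\<sigma> \<subseteq> (\<lambda>S. {S}) ` proper_clusters n \<union> U" using D(1) assms by blast
    show "laminar (clusters_in \<sigma>)" by (rule D(3))
  qed (use D(2,4) in \<open>meson insertI2\<close>)+
next
  assume "\<sigma> \<in> nested_complex n U \<and> \<not> factors \<subseteq> \<sigma>"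
  then have \<sigma>: "\<sigma> \<in> nested_complex n U" and no: "\<not> x \<subseteq> clusters_in \<sigma>"
    using factors_subset_iff[of \<sigma>] by blast+
  note D = nested_complexD[OF \<sigma>]
  show "\<sigma> \<in> nested_complex n (insert x U)"
  proof (rule nested_complexI)
    show "\<sigma> \<subseteq> (\<lambda>S. {S}) ` proper_clusters n \<union> insert x U" using D(1) by blast
    show "laminar (clusters_in \<sigma>)" by (rule D(3))
    show "below u v \<or> below v u" if "u \<in> \<sigma>" "u \<in> insert x U" "v \<in> \<sigma>" for u v
      using D(2)[of u v] that assms by blast
    show "A \<notin> insert x U" if "A \<subseteq> clusters_in \<sigma>" "disjoint A" "2 \<le> card A" for A
      using D(4)[OF that] no that(1) by blast
  qed
qed

text \<open>Members of \<open>U\<close> that are comparable to \<open>x\<close> lie above it. A cluster comparable to \<open>x\<close> is contained in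
  a block of \<open>x\<close> or contains all of them. In the second case no other cluster comparable to \<open>x\<close> is
  disjoint from it, so two or more disjoint clusters have a join below \<open>x\<close>, which is not in \<open>U\<close>.\<close>

lemma nested_complex_insert_imp_factors:
  assumes \<tau>: "insert x \<tau> \<in> nested_complex n (insert x U)" and "x \<notin> \<tau>"
  shows "\<tau> \<union> factors \<in> nested_complex n U"
proof (rule nested_complexI)
  note D = nested_complexD[OF \<tau>]
  have comparable: "below x v \<or> below v x" if "v \<in> \<tau>" for v
    using D(2)[of x v] that by blast
  have "\<tau> \<in> nested_complex n (insert x U)" using nested_complex_subset[OF \<tau>] by blast
  then have "\<tau> \<in> nested_complex n U" using nested_complex_insert_without[OF \<open>x \<notin> \<tau>\<close>] by blast
  note DU = nested_complexD[OF this]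
  show "\<tau> \<union> factors \<subseteq> (\<lambda>S. {S}) ` proper_clusters n \<union> U"
    using DU(1) composite_blocks[OF x(1)] by blast
  show "below u v \<or> below v u" if u: "u \<in> \<tau> \<union> factors" "u \<in> U" and v: "v \<in> \<tau> \<union> factors" for u v
  proof -
    have "u \<notin> factors" using u(2) U singleton_not_composite by blast
    then have "u \<in> \<tau>" using u(1) by blast
    then have "below x u" using comparable x_not_below u(2) by blast
    moreover have "below v x" if "v \<in> factors" using that by (auto simp: below_def)
    ultimately show ?thesis using DU(2)[OF \<open>u \<in> \<tau>\<close> u(2)] v below_trans by blast
  qed
  have cl: "(\<exists>B\<in>x. S \<subseteq> B) \<or> (\<forall>B\<in>x. B \<subseteq> S)" if "S \<in> clusters_in \<tau>" for S
    using comparable[of "{S}"] that by (auto simp: clusters_in_def below_def)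
  have mixed: "S \<inter> B = {} \<or> S \<subseteq> B \<or> B \<subseteq> S" if "S \<in> clusters_in \<tau>" "B \<in> x" for S B
    using cl[OF that(1)] proper_blocksD(7)[OF x_blocks(1) _ that(2)] that(2) by blast
  have x_disjoint: "B \<inter> B' = {} \<or> B = B'" if "B \<in> x" "B' \<in> x" for B B'
    using proper_blocksD(7)[OF x_blocks(1) that] by blast
  show "laminar (clusters_in (\<tau> \<union> factors))"
    unfolding clusters_in_factors laminar_def
  proof (intro ballI)
    fix S T assume "S \<in> clusters_in \<tau> \<union> x" "T \<in> clusters_in \<tau> \<union> x"
    then consider "S \<in> clusters_in \<tau>" "T \<in> clusters_in \<tau>" | "S \<in> clusters_in \<tau>" "T \<in> x"
      | "S \<in> x" "T \<in> clusters_in \<tau>" | "S \<in> x" "T \<in> x" by blast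
    then show "S \<inter> T = {} \<or> S \<subseteq> T \<or> T \<subseteq> S"
    proof cases
      case 1
      then show ?thesis using DU(3) unfolding laminar_def by blast
    next
      case 2
      then show ?thesis by (rule mixed)
    next
      case 3
      then show ?thesis using mixed[of T S] by blast
    next
      case 4
      then show ?thesis using x_disjoint by blast
    qed
  qed
  show "A \<notin> U" if A: "A \<subseteq> clusters_in (\<tau> \<union> factors)" "disjoint A" "2 \<le> card A" for A
  proof (cases "below A x")
    case True
    then show ?thesis using x_not_below by blast
  next
    case False
    then obtain S where S: "S \<in> A" "\<forall>B\<in>x. \<not> S \<subseteq> B" unfolding below_def by blast
    have cases_A: "T \<in> clusters_in \<tau> \<or> T \<in> x" if "T \<in> A" for T
      using A(1) that unfolding clusters_in_factors by blast
    have over: "\<forall>B\<in>x. B \<subseteq> S"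
      using cases_A[OF S(1)] cl[of S] S(2) by (metis order_refl)
    have "A \<noteq> {S}" using A(3) by auto
    then obtain S' where S': "S' \<in> A" "S' \<noteq> S" using S(1) by blast
    then have dis: "S \<inter> S' = {}" using A(2) S(1) unfolding pairwise_def disjnt_def by blast
    have "clusters_in (\<tau> \<union> factors) \<subseteq> proper_clusters n"
      by (rule clusters_in_proper) (use DU(1) composite_blocks[OF x(1)] in blast)
    then have S'_ne: "S' \<noteq> {}" using proper_clustersD(3) A(1) S'(1) by blast
    have "S \<inter> S' \<noteq> {}"
    proof (cases "\<exists>B\<in>x. S' \<subseteq> B")
      case True
      then have "S' \<subseteq> S" using over by blast
      then show ?thesis using S'_ne by blast
    next
      case False
      then have "S' \<notin> x" by blast
      then have "\<forall>B\<in>x. B \<subseteq> S'" using cases_A[OF S'(1)] cl[of S'] False by blast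
      moreover obtain B where "B \<in> x" using proper_blocksD(1)[OF x_blocks(1)] by blast
      moreover from this have "B \<noteq> {}" by (rule proper_blocksD(6)[OF x_blocks(1)])
      ultimately show ?thesis using over by blast
    qed
    with dis show ?thesis by contradiction
  qed
qed

text \<open>A member of \<open>U\<close> is not below any block of \<open>x\<close>, so if it is comparable to all of them, it is above
  \<open>x\<close>. If a cluster \<open>S\<close> of the simplex were not comparable to \<open>x\<close>, then \<open>S\<close> and the blocks of \<open>x\<close>
  disjoint from it would be disjoint clusters whose join is strictly above \<open>x\<close>, hence in \<open>U\<close>.\<close>

lemma nested_complex_factors_imp_insert:
  assumes \<tau>: "\<tau> \<in> nested_complex n U" "\<not> factors \<subseteq> \<tau>" and F: "\<tau> \<union> factors \<in> nested_complex n U"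
  shows "insert x \<tau> \<in> nested_complex n (insert x U)"
proof (rule nested_complexI)
  note D = nested_complexD[OF F] and D\<tau> = nested_complexD[OF \<tau>(1)]
  have "x \<notin> (\<lambda>S. {S}) ` proper_clusters n" using x(1) singleton_not_composite by blast
  then have "x \<notin> \<tau>" using D\<tau>(1) x(2) by blast
  then have ins: "\<tau> \<in> nested_complex n (insert x U)"
    using nested_complex_insert_without \<tau> by blast
  note DI = nested_complexD[OF ins]
  show "insert x \<tau> \<subseteq> (\<lambda>S. {S}) ` proper_clusters n \<union> insert x U" using DI(1) by blast
  show "laminar (clusters_in (insert x \<tau>))" using DI(3) by (simp only: clusters_in_insert)
  show "A \<notin> insert x U" if "A \<subseteq> clusters_in (insert x \<tau>)" "disjoint A" "2 \<le> card A" for A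
    using DI(4)[of A] that unfolding clusters_in_insert .
  have comparable: "below x v \<or> below v x" if v: "v \<in> \<tau>" for v
  proof (cases "v \<in> U")
    case True
    have "below {B} v" if B: "B \<in> x" for B
    proof -
      have "\<not> below v {B}"
      proof
        assume "below v {B}"
        moreover have "below {B} x" using B by (auto simp: below_def)
        ultimately show False using x_not_below[OF True] below_trans by blast
      qed
      then show ?thesis using D(2)[of v "{B}"] v True B by blast
    qed
    then have "below x v" by (auto simp: below_def)
    then show ?thesis ..
  next
    case False
    then obtain S where S: "v = {S}" "S \<in> proper_clusters n" using D\<tau>(1) v by blast
    show ?thesis
    proof (rule ccontr)
      assume no: "\<not> (below x v \<or> below v x)"
      then have in_no: "\<not> S \<subseteq> B" if "B \<in> x" for B using that S(1) by (auto simp: below_def)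
      obtain B0 where B0: "B0 \<in> x" "\<not> B0 \<subseteq> S" using no S(1) by (auto simp: below_def)
      define A where "A = insert S {B \<in> x. B \<inter> S = {}}"
      have Scl: "S \<in> clusters_in (\<tau> \<union> factors)" using v S(1) by (simp add: clusters_in_def)
      have lam: "S \<inter> B = {} \<or> B \<subseteq> S" if "B \<in> x" for B
        using D(3) Scl that in_no[OF that] unfolding laminar_def clusters_in_factors by blast
      have sub: "A \<subseteq> clusters_in (\<tau> \<union> factors)"
        using Scl unfolding A_def clusters_in_factors by blast
      have dis: "disjoint A"
        using x_blocks(2) unfolding A_def pairwise_def disjnt_def by blast
      have "S \<noteq> B0" using in_no[OF B0(1)] by blast
      moreover have "B0 \<in> A" using lam[OF B0(1)] B0 unfolding A_def by blast
      moreover have "S \<in> A" by (simp add: A_def)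
      moreover have "finite A" using proper_blocksD(3)[OF x_blocks(1)] by (simp add: A_def)
      ultimately have card: "2 \<le> card A" using card_mono[of A "{S, B0}"] by simp
      have "A \<subseteq> proper_clusters n"
        using S(2) composite_blocks[OF x(1)] unfolding A_def by blast
      then have comp: "A \<in> composites n" using dis card by (rule disjoint_clusters_composite)
      have "below x A"
        unfolding below_def
      proof
        fix B assume "B \<in> x"
        with lam[OF this] show "\<exists>T\<in>A. B \<subseteq> T" unfolding A_def by blast
      qed
      then have "A = x \<or> A \<in> U" using above_x[OF comp] by blast
      moreover have "A \<noteq> x" using \<open>S \<in> A\<close> in_no by blast
      ultimately show False using D(4)[OF sub dis card] by blast
    qed
  qed
  show "below u v \<or> below v u" if "u \<in> insert x \<tau>" "u \<in> insert x U" "v \<in> insert x \<tau>" for u v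
    using that comparable DI(2)[of u v] below_refl by blast
qed

lemma factors_in_nested_complex: "factors \<in> nested_complex n U"
proof -
  have "insert x {} \<in> nested_complex n (insert x U)"
  proof (rule nested_complexI)
    have none: "clusters_in (insert x {}) = {}"
      using clusters_in_insert[of "{}"] by (simp add: clusters_in_def)
    show "laminar (clusters_in (insert x {}))" unfolding none by (simp add: laminar_def)
    show "A \<notin> insert x U" if "A \<subseteq> clusters_in (insert x {})" "2 \<le> card A" for A
      using that unfolding none by simp
  qed (auto intro: below_refl)
  then show ?thesis using nested_complex_insert_imp_factors[of "{}"] by simp
qed

lemma nested_complex_insert:
  "nested_complex n (insert x U) = stellar_subdivision (nested_complex n U) factors x"
proof (intro equalityI subsetI)
  fix \<sigma> assume \<sigma>: "\<sigma> \<in> nested_complex n (insert x U)"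
  show "\<sigma> \<in> stellar_subdivision (nested_complex n U) factors x"
  proof (cases "x \<in> \<sigma>")
    case False
    have "\<sigma> \<in> nested_complex n U \<and> \<not> factors \<subseteq> \<sigma>"
      using nested_complex_insert_without[OF False] \<sigma> by (rule iffD1)
    then show ?thesis unfolding stellar_subdivision_def by (intro UnI1 CollectI)
  next
    case True
    define \<tau> where "\<tau> = \<sigma> - {x}"
    have \<tau>: "\<sigma> = insert x \<tau>" "x \<notin> \<tau>" using True by (auto simp: \<tau>_def)
    have "\<tau> \<in> nested_complex n (insert x U)" by (rule nested_complex_subset[OF \<sigma>]) (auto simp: \<tau>_def)
    then have "\<tau> \<in> nested_complex n U \<and> \<not> factors \<subseteq> \<tau>"
      by (rule iffD1[OF nested_complex_insert_without[OF \<tau>(2)]])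
    moreover have "\<tau> \<union> factors \<in> nested_complex n U"
      using nested_complex_insert_imp_factors[OF _ \<tau>(2)] \<sigma> unfolding \<tau>(1) .
    ultimately show ?thesis
      unfolding stellar_subdivision_def using \<tau>(1) by (intro UnI2 CollectI exI[of _ \<tau>] conjI) simp_all
  qed
next
  fix \<sigma> assume "\<sigma> \<in> stellar_subdivision (nested_complex n U) factors x"
  then consider "\<sigma> \<in> nested_complex n U" "\<not> factors \<subseteq> \<sigma>"
    | \<tau> where "\<sigma> = insert x \<tau>" "\<tau> \<in> nested_complex n U" "\<not> factors \<subseteq> \<tau>" "\<tau> \<union> factors \<in> nested_complex n U"
    unfolding stellar_subdivision_def by blast
  then show "\<sigma> \<in> nested_complex n (insert x U)"
  proof cases
    case 1
    have "x \<notin> (\<lambda>S. {S}) ` proper_clusters n" using x(1) singleton_not_composite by blast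
    then have "x \<notin> \<sigma>" using nested_complexD(1)[OF 1(1)] x(2) by blast
    from nested_complex_insert_without[OF this] 1 show ?thesis by simp
  next
    case 2
    show ?thesis unfolding 2(1) by (rule nested_complex_factors_imp_insert[OF 2(2-4)])
  qed
qed

end

lemma finite_proper_blocks: "finite (proper_blocks n)"
proof (rule finite_subset)
  show "proper_blocks n \<subseteq> Pow (Pow {1..n})"
    using proper_blocksD(4) by blast
qed simp

lemma singleton_in_proper_blocks: "S \<in> proper_clusters n \<Longrightarrow> {S} \<in> proper_blocks n"
  using proper_clustersD[of S n] by (simp add: proper_blocks_def)

lemma proper_blocks_eq: "proper_blocks n = (\<lambda>S. {S}) ` proper_clusters n \<union> composites n"
proof (intro equalityI subsetI)
  fix p assume p: "p \<in> proper_blocks n"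
  note D = proper_blocksD[OF p]
  show "p \<in> (\<lambda>S. {S}) ` proper_clusters n \<union> composites n"
  proof (cases "2 \<le> card p")
    case True
    then show ?thesis using p by (simp add: composites_def)
  next
    case False
    moreover have "card p \<noteq> 0" using D(1,3) by simp
    ultimately have "card p = 1" by linarith
    then obtain S where S: "p = {S}" by (rule card_1_singletonE)
    then have "S \<subset> {1..n}" "2 \<le> card S" using D(2) D(4,5)[of S] by blast+
    then have "S \<in> proper_clusters n"
      using psubset_card_mono[of "{1..n}" S] by (simp add: proper_clusters_def psubset_imp_subset)
    then show ?thesis using S by blast
  qed
next
  fix p assume "p \<in> (\<lambda>S. {S}) ` proper_clusters n \<union> composites n"
  then show "p \<in> proper_blocks n"
    using singleton_in_proper_blocks by (auto simp: composites_def)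
qed

text \<open>The new vertices are taken from a given set, so that a single injection on this set transports a
  whole sequence of subdivisions.\<close>

definition stellar_step_within :: "'a set \<Rightarrow> 'a set set \<Rightarrow> 'a set set \<Rightarrow> bool" where
  "stellar_step_within W K L \<longleftrightarrow>
     \<Union>K \<subseteq> W \<and> (\<exists>F v. F \<in> K \<and> F \<noteq> {} \<and> v \<in> W - \<Union>K \<and> L = stellar_subdivision K F v)"

text \<open>Partitions are added from coarse to fine: all coarser composites are present when the simplex of
  the nontrivial blocks of a partition is subdivided.\<close>

lemma nested_complex_steps:
  assumes "U \<subseteq> composites n" "\<And>u v. u \<in> U \<Longrightarrow> v \<in> composites n \<Longrightarrow> below u v \<Longrightarrow> v \<in> U"
  shows "(stellar_step_within (proper_blocks n))\<^sup>*\<^sup>* (nested_complex n U) (nested_complex n (composites n))"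
  using assms
proof (induction "card (composites n - U)" arbitrary: U rule: less_induct)
  case less
  note U = less.prems(1) and up = less.prems(2)
  have fin: "finite (composites n)"
    using finite_proper_blocks by (simp add: composites_def)
  show ?case
  proof (cases "composites n - U = {}")
    case True
    then have "U = composites n" using U by blast
    then show ?thesis by simp
  next
    case False
    have trans: "below p r \<and> p \<noteq> r"
      if "p \<in> composites n" "q \<in> composites n" "below p q \<and> p \<noteq> q" "below q r \<and> q \<noteq> r" for p q r
      using that below_trans[of p q r] below_antisym[of p n q] by (auto simp: composites_def)
    have "\<exists>x\<in>composites n - U. \<forall>v\<in>composites n - U. v \<noteq> x \<longrightarrow> \<not> (below x v \<and> x \<noteq> v)"
    proof (rule Finite_Set.bex_max_element)
      show "asymp_on (composites n - U) (\<lambda>p q. below p q \<and> p \<noteq> q)"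
        using below_antisym by (intro asymp_onI) (auto simp: composites_def)
      show "transp_on (composites n - U) (\<lambda>p q. below p q \<and> p \<noteq> q)"
        using trans by (intro transp_onI) blast
    qed (use fin False in simp_all)
    then obtain x where x: "x \<in> composites n" "x \<notin> U"
      and max: "\<And>v. v \<in> composites n \<Longrightarrow> below x v \<Longrightarrow> v = x \<or> v \<in> U" by blast
    have "stellar_step_within (proper_blocks n) (nested_complex n U) (nested_complex n (insert x U))"
      unfolding stellar_step_within_def
    proof (intro exI conjI)
      show "nested_complex n (insert x U) = stellar_subdivision (nested_complex n U) ((\<lambda>S. {S}) ` x) x"
        by (rule nested_complex_insert[OF U x up max])
      show "(\<lambda>S. {S}) ` x \<in> nested_complex n U"
        by (rule factors_in_nested_complex[OF U x up max])
      show "(\<lambda>S. {S}) ` x \<noteq> {}" using x(1) by (auto simp: composites_def)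
      have V: "\<Union>(nested_complex n U) \<subseteq> (\<lambda>S. {S}) ` proper_clusters n \<union> U"
        using nested_complexD(1) by blast
      then show "\<Union>(nested_complex n U) \<subseteq> proper_blocks n" using U proper_blocks_eq by blast
      have "x \<notin> (\<lambda>S. {S}) ` proper_clusters n" using x(1) singleton_not_composite by blast
      then have "x \<notin> \<Union>(nested_complex n U)" using V x(2) by (meson UnE subsetD)
      then show "x \<in> proper_blocks n - \<Union>(nested_complex n U)"
        using x(1) by (simp add: composites_def)
    qed
    moreover have "(stellar_step_within (proper_blocks n))\<^sup>*\<^sup>*
        (nested_complex n (insert x U)) (nested_complex n (composites n))"
    proof (rule less.hyps)
      show "card (composites n - insert x U) < card (composites n - U)"
        by (rule psubset_card_mono) (use fin x in auto)
      show "insert x U \<subseteq> composites n" using U x(1) by blast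
      show "v \<in> insert x U" if "u \<in> insert x U" "v \<in> composites n" "below u v" for u v
        using that up max by blast
    qed
    ultimately show ?thesis by (rule converse_rtranclp_into_rtranclp)
  qed
qed

lemma nested_complex_empty: "nested_complex n {} = (`) (\<lambda>S. {S}) ` laminar_complex n"
proof (intro equalityI subsetI)
  fix \<sigma> assume \<sigma>: "\<sigma> \<in> nested_complex n {}"
  note D = nested_complexD[OF \<sigma>]
  have "\<sigma> = (\<lambda>S. {S}) ` clusters_in \<sigma>" "clusters_in \<sigma> \<subseteq> proper_clusters n"
    using D(1) by (auto simp: clusters_in_def)
  then show "\<sigma> \<in> (`) (\<lambda>S. {S}) ` laminar_complex n"
    using D(3) unfolding laminar_complex_def by blast
next
  fix \<sigma> assume "\<sigma> \<in> (`) (\<lambda>S. {S}) ` laminar_complex n"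
  then obtain F where F: "F \<subseteq> proper_clusters n" "laminar F" "\<sigma> = (\<lambda>S. {S}) ` F"
    by (auto simp: laminar_complex_def)
  have "clusters_in \<sigma> = F" by (auto simp: clusters_in_def F(3))
  then show "\<sigma> \<in> nested_complex n {}" by (intro nested_complexI) (use F in auto)
qed

text \<open>Once all composites are present, two disjoint clusters cannot occur together, because their join
  is among the composites. So all members of a simplex are comparable.\<close>

lemma nested_complex_composites:
  "nested_complex n (composites n) =
     {\<sigma>. \<sigma> \<subseteq> proper_blocks n \<and> (\<forall>p\<in>\<sigma>. \<forall>q\<in>\<sigma>. below p q \<or> below q p)}"
proof (intro equalityI subsetI)
  fix \<sigma> assume \<sigma>: "\<sigma> \<in> nested_complex n (composites n)"
  note D = nested_complexD[OF \<sigma>]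
  have "below p q \<or> below q p" if pq: "p \<in> \<sigma>" "q \<in> \<sigma>" for p q
  proof (cases "p \<in> composites n \<or> q \<in> composites n")
    case True
    then show ?thesis using D(2)[of p q] D(2)[of q p] pq by blast
  next
    case False
    then have "p \<in> (\<lambda>S. {S}) ` proper_clusters n" "q \<in> (\<lambda>S. {S}) ` proper_clusters n"
      using subsetD[OF D(1) pq(1)] subsetD[OF D(1) pq(2)] by simp_all
    then obtain S T where S: "p = {S}" "S \<in> proper_clusters n" and T: "q = {T}" "T \<in> proper_clusters n"
      by (elim imageE) (rule that)
    have "S \<inter> T \<noteq> {}"
    proof
      assume dis: "S \<inter> T = {}"
      then have "S \<noteq> T" using proper_clustersD(3)[OF S(2)] by blast
      then have A: "disjoint {S, T}" "2 \<le> card {S, T}" using dis by (auto simp: pairwise_def disjnt_def)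
      then have "{S, T} \<in> composites n" using S(2) T(2) by (intro disjoint_clusters_composite) auto
      moreover have "{S, T} \<subseteq> clusters_in \<sigma>" using pq S(1) T(1) by (simp add: clusters_in_def)
      ultimately show False using D(4) A by blast
    qed
    moreover have "S \<in> clusters_in \<sigma>" "T \<in> clusters_in \<sigma>" using pq S(1) T(1) by (simp_all add: clusters_in_def)
    ultimately have "S \<subseteq> T \<or> T \<subseteq> S" using D(3) unfolding laminar_def by blast
    then show ?thesis using S(1) T(1) by (simp add: below_def)
  qed
  moreover have "\<sigma> \<subseteq> proper_blocks n" using D(1) proper_blocks_eq by simp
  ultimately show "\<sigma> \<in> {\<sigma>. \<sigma> \<subseteq> proper_blocks n \<and> (\<forall>p\<in>\<sigma>. \<forall>q\<in>\<sigma>. below p q \<or> below q p)}"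
    by simp
next
  fix \<sigma> assume "\<sigma> \<in> {\<sigma>. \<sigma> \<subseteq> proper_blocks n \<and> (\<forall>p\<in>\<sigma>. \<forall>q\<in>\<sigma>. below p q \<or> below q p)}"
  then have \<sigma>: "\<sigma> \<subseteq> proper_blocks n" "\<And>p q. p \<in> \<sigma> \<Longrightarrow> q \<in> \<sigma> \<Longrightarrow> below p q \<or> below q p"
    by simp_all
  have nested: "S \<subseteq> T \<or> T \<subseteq> S" if "S \<in> clusters_in \<sigma>" "T \<in> clusters_in \<sigma>" for S T
    using \<sigma>(2)[of "{S}" "{T}"] that by (simp add: clusters_in_def below_def)
  show "\<sigma> \<in> nested_complex n (composites n)"
  proof (rule nested_complexI)
    show "\<sigma> \<subseteq> (\<lambda>S. {S}) ` proper_clusters n \<union> composites n" using \<sigma>(1) proper_blocks_eq by simp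
    show "laminar (clusters_in \<sigma>)" using nested unfolding laminar_def by simp
    show "A \<notin> composites n" if A: "A \<subseteq> clusters_in \<sigma>" "disjoint A" "2 \<le> card A" for A
    proof
      assume "A \<in> composites n"
      then have blocks: "S \<noteq> {}" if "S \<in> A" for S
        using proper_clustersD(3) composite_blocks that by blast
      have "S = T" if "S \<in> A" "T \<in> A" for S T
      proof (rule ccontr)
        assume "S \<noteq> T"
        then have "S \<inter> T = {}" using A(2) that unfolding pairwise_def disjnt_def by blast
        moreover have "S \<subseteq> T \<or> T \<subseteq> S" using nested that A(1) by blast
        ultimately show False using blocks that by blast
      qed
      then have "card A \<le> Suc 0" using A(3) by (intro card_le_Suc0_iff_eq[THEN iffD2]) (auto intro: card_ge_0_finite)
      then show False using A(3) by simp
    qed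
  qed (use \<sigma>(2) in blast)
qed


section \<open>The order complex of the partition lattice\<close>

definition add_singletons :: "nat \<Rightarrow> nat set set \<Rightarrow> nat set set" where
  "add_singletons n p = p \<union> (\<lambda>i. {i}) ` ({1..n} - \<Union>p)"

lemma blocks_of_add_singletons:
  assumes "p \<in> proper_blocks n"
  shows "{S \<in> add_singletons n p. 2 \<le> card S} = p"
  using proper_blocksD(5)[OF assms] by (auto simp: add_singletons_def)

lemma partition_on_add_singletons:
  assumes p: "p \<in> proper_blocks n"
  shows "partition_on {1..n} (add_singletons n p)"
proof (rule partition_onI)
  note D = proper_blocksD[OF p]
  show "\<Union>(add_singletons n p) = {1..n}" using D(4) by (auto simp: add_singletons_def)
  show "{} \<notin> add_singletons n p" using D(6) by (auto simp: add_singletons_def)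
  fix S T assume "S \<in> add_singletons n p" "T \<in> add_singletons n p" "S \<noteq> T"
  then show "disjnt S T" using D(7) by (auto simp: add_singletons_def disjnt_def)
qed

lemma bij_betw_add_singletons: "bij_betw (add_singletons n) (proper_blocks n) (proper_partitions n)"
proof (rule bij_betw_byWitness[where f' = "\<lambda>P. {S \<in> P. 2 \<le> card S}"])
  show "\<forall>p\<in>proper_blocks n. {S \<in> add_singletons n p. 2 \<le> card S} = p"
    using blocks_of_add_singletons by blast
  have large: "S \<subseteq> {1..n} \<and> (card S < 2 \<longrightarrow> (\<exists>i\<in>{1..n}. S = {i}))" if "partition_on {1..n} P" "S \<in> P" for P S
  proof -
    have S: "S \<subseteq> {1..n}" "S \<noteq> {}" using that partition_onD1 partition_onD3 by blast+
    moreover have "card S \<noteq> 0" using S finite_subset[of S "{1..n}"] by auto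
    then have "card S = 1" if "card S < 2" using that by linarith
    ultimately show ?thesis by (metis card_1_singletonE insert_subset)
  qed
  show "\<forall>P\<in>proper_partitions n. add_singletons n {S \<in> P. 2 \<le> card S} = P"
  proof
    fix P assume "P \<in> proper_partitions n"
    then have P: "partition_on {1..n} P" by (simp add: proper_partitions_def partition_lattice_def)
    show "add_singletons n {S \<in> P. 2 \<le> card S} = P"
    proof (intro equalityI subsetI)
      fix S assume "S \<in> add_singletons n {S \<in> P. 2 \<le> card S}"
      then consider "S \<in> P" | i where "S = {i}" "i \<in> {1..n}" "i \<notin> \<Union>{S \<in> P. 2 \<le> card S}"
        unfolding add_singletons_def by blast
      then show "S \<in> P"
      proof cases
        case 2
        then obtain T where T: "T \<in> P" "i \<in> T" using partition_onD1[OF P] by blast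
        have "\<not> 2 \<le> card T"
        proof
          assume "2 \<le> card T"
          then have "T \<in> {S \<in> P. 2 \<le> card S}" using T(1) by simp
          then have "i \<in> \<Union>{S \<in> P. 2 \<le> card S}" using T(2) by (rule UnionI)
          with 2(3) show False by contradiction
        qed
        then have "card T < 2" by simp
        then obtain j where "T = {j}" using large[OF P T(1)] by blast
        then show ?thesis using T 2(1) by simp
      qed
    next
      fix S assume S: "S \<in> P"
      show "S \<in> add_singletons n {S \<in> P. 2 \<le> card S}"
      proof (cases "2 \<le> card S")
        case True
        then show ?thesis using S by (simp add: add_singletons_def)
      next
        case False
        then obtain i where i: "i \<in> {1..n}" "S = {i}" using large[OF P S] by auto
        have "i \<notin> \<Union>{S \<in> P. 2 \<le> card S}"
        proof
          assume "i \<in> \<Union>{S \<in> P. 2 \<le> card S}"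
          then obtain T where T: "T \<in> P" "2 \<le> card T" "i \<in> T" by blast
          then have "S \<noteq> T" using False by blast
          then have "disjnt S T" using partition_onD2[OF P] S T(1) by (meson pairwiseD)
          then show False using T(3) i(2) by (simp add: disjnt_def)
        qed
        then show ?thesis using i unfolding add_singletons_def by blast
      qed
    qed
  qed
  show "add_singletons n ` proper_blocks n \<subseteq> proper_partitions n"
  proof (rule image_subsetI)
    fix p assume p: "p \<in> proper_blocks n"
    note D = proper_blocksD[OF p]
    obtain S where S: "S \<in> p" using D(1) by blast
    then have "S \<in> add_singletons n p" by (simp add: add_singletons_def)
    moreover have "S \<notin> (\<lambda>i. {i}) ` {1..n}" using D(5)[OF S] by auto
    ultimately have "add_singletons n p \<noteq> (\<lambda>i. {i}) ` {1..n}" by metis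
    moreover have "add_singletons n p \<noteq> {{1..n}}"
    proof
      assume "add_singletons n p = {{1..n}}"
      then have "p \<subseteq> {{1..n}}" unfolding add_singletons_def by blast
      then show False using D(1,2) by blast
    qed
    ultimately show "add_singletons n p \<in> proper_partitions n"
      using partition_on_add_singletons[OF p] by (simp add: proper_partitions_def partition_lattice_def)
  qed
  show "(\<lambda>P. {S \<in> P. 2 \<le> card S}) ` proper_partitions n \<subseteq> proper_blocks n"
  proof (rule image_subsetI)
    fix P assume "P \<in> proper_partitions n"
    then have P: "partition_on {1..n} P" "P \<noteq> (\<lambda>i. {i}) ` {1..n}" "P \<noteq> {{1..n}}"
      by (simp_all add: proper_partitions_def partition_lattice_def)
    have "{S \<in> P. 2 \<le> card S} \<noteq> {}"
    proof
      assume "{S \<in> P. 2 \<le> card S} = {}"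
      then have "\<exists>i\<in>{1..n}. S = {i}" if "S \<in> P" for S using large[OF P(1) that] that by fastforce
      then have sub: "P \<subseteq> (\<lambda>i. {i}) ` {1..n}" by blast
      moreover have "{i} \<in> P" if i: "i \<in> {1..n}" for i
      proof -
        obtain T where T: "T \<in> P" "i \<in> T" using partition_onD1[OF P(1)] i by blast
        then have "T = {i}" using sub by auto
        then show ?thesis using T(1) by simp
      qed
      ultimately show False using P(2) by blast
    qed
    moreover have "{S \<in> P. 2 \<le> card S} \<noteq> {{1..n}}"
    proof
      assume "{S \<in> P. 2 \<le> card S} = {{1..n}}"
      then have top: "{1..n} \<in> P" by blast
      have "S = {1..n}" if S: "S \<in> P" for S
      proof (rule ccontr)
        assume "S \<noteq> {1..n}"
        then have "disjnt S {1..n}" using partition_onD2[OF P(1)] S top by (meson pairwiseD)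
        moreover have "S \<subseteq> {1..n}" "S \<noteq> {}" using large[OF P(1) S] partition_onD3[OF P(1)] S by blast+
        ultimately show False unfolding disjnt_def by blast
      qed
      then show False using P(3) top by blast
    qed
    moreover have "disjoint {S \<in> P. 2 \<le> card S}"
      using partition_onD2[OF P(1)] by (rule pairwise_subset) blast
    ultimately show "{S \<in> P. 2 \<le> card S} \<in> proper_blocks n"
      using large[OF P(1)] by (simp add: proper_blocks_def)
  qed
qed

lemma refines_add_singletons_iff:
  assumes p: "p \<in> proper_blocks n" and q: "q \<in> proper_blocks n"
  shows "refines {1..n} (add_singletons n p) (add_singletons n q) \<longleftrightarrow> below p q"
proof
  assume r: "refines {1..n} (add_singletons n p) (add_singletons n q)"
  show "below p q"
    unfolding below_def
  proof
    fix S assume S: "S \<in> p"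
    then have "S \<in> add_singletons n p" by (simp add: add_singletons_def)
    then obtain T where T: "T \<in> add_singletons n q" "S \<subseteq> T" using r unfolding refines_def by blast
    have "card T \<noteq> 1"
    proof
      assume "card T = 1"
      then have "card S \<le> 1" using card_mono[OF _ T(2)] by (metis card_ge_0_finite zero_less_one)
      then show False using proper_blocksD(5)[OF p S] by simp
    qed
    then have "T \<in> q" using T(1) by (auto simp: add_singletons_def)
    then show "\<exists>T\<in>q. S \<subseteq> T" using T(2) by blast
  qed
next
  assume b: "below p q"
  have "\<exists>T\<in>add_singletons n q. S \<subseteq> T" if S: "S \<in> add_singletons n p" for S
  proof (cases "S \<in> p")
    case True
    then show ?thesis using b unfolding below_def add_singletons_def by blast
  next
    case False
    then obtain i where "S = {i}" "i \<in> {1..n}" using S unfolding add_singletons_def by blast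
    moreover from this(2) obtain T where "T \<in> add_singletons n q" "i \<in> T"
      using partition_onD1[OF partition_on_add_singletons[OF q]] by blast
    ultimately show ?thesis by blast
  qed
  then show "refines {1..n} (add_singletons n p) (add_singletons n q)"
    using partition_on_add_singletons p q unfolding refines_def by blast
qed

lemma order_complex_eq:
  "order_complex (refines {1..n}) (proper_partitions n) =
     (`) (add_singletons n) ` nested_complex n (composites n)"
proof -
  let ?h = "add_singletons n"
  have chain: "Complete_Partial_Order.chain (refines {1..n}) (?h ` \<sigma>) \<longleftrightarrow>
      (\<forall>p\<in>\<sigma>. \<forall>q\<in>\<sigma>. below p q \<or> below q p)" if "\<sigma> \<subseteq> proper_blocks n" for \<sigma>
    using refines_add_singletons_iff that unfolding chain_def by blast
  have img: "?h ` proper_blocks n = proper_partitions n"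
    using bij_betw_add_singletons by (simp add: bij_betw_def)
  show ?thesis
  proof (intro equalityI subsetI)
    fix C assume "C \<in> order_complex (refines {1..n}) (proper_partitions n)"
    then have C: "C \<subseteq> proper_partitions n" "Complete_Partial_Order.chain (refines {1..n}) C"
      by (simp_all add: order_complex_def)
    then obtain \<sigma> where "\<sigma> \<subseteq> proper_blocks n" "C = ?h ` \<sigma>" unfolding img[symmetric] by (meson subset_imageE)
    then show "C \<in> (`) ?h ` nested_complex n (composites n)"
      using chain C(2) unfolding nested_complex_composites by blast
  next
    fix C assume "C \<in> (`) ?h ` nested_complex n (composites n)"
    then obtain \<sigma> where \<sigma>: "\<sigma> \<subseteq> proper_blocks n" "\<forall>p\<in>\<sigma>. \<forall>q\<in>\<sigma>. below p q \<or> below q p" "C = ?h ` \<sigma>"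
      unfolding nested_complex_composites by blast
    moreover have "finite C" using \<sigma>(1,3) finite_subset[OF _ finite_proper_blocks] by blast
    moreover have "C \<subseteq> proper_partitions n" using \<sigma>(1,3) img by blast
    ultimately show "C \<in> order_complex (refines {1..n}) (proper_partitions n)"
      using chain by (simp add: order_complex_def)
  qed
qed

section \<open>Transport along injections of the vertices\<close>

lemma stellar_subdivision_image:
  assumes "inj_on f W" "\<Union>K \<subseteq> W" "F \<subseteq> W" "v \<in> W"
  shows "(`) f ` stellar_subdivision K F v = stellar_subdivision ((`) f ` K) (f ` F) (f v)"
proof -
  have sub: "f ` F \<subseteq> f ` \<sigma> \<longleftrightarrow> F \<subseteq> \<sigma>" if "\<sigma> \<in> K" for \<sigma>
  proof -
    have \<sigma>: "\<sigma> \<subseteq> W" using that assms(2) by blast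
    have "f ` F \<subseteq> f ` \<sigma> \<longleftrightarrow> f ` (F \<union> \<sigma>) = f ` \<sigma>" by (simp add: image_Un subset_Un_eq)
    also have "\<dots> \<longleftrightarrow> F \<union> \<sigma> = \<sigma>" using inj_on_image_eq_iff[OF assms(1)] assms(3) \<sigma> by simp
    finally show ?thesis by (simp add: subset_Un_eq)
  qed
  have mem: "f ` \<sigma> \<in> (`) f ` K \<longleftrightarrow> \<sigma> \<in> K" if "\<sigma> \<subseteq> W" for \<sigma>
  proof -
    have "K \<subseteq> Pow W" using assms(2) by blast
    then show ?thesis
      using inj_on_image_mem_iff[OF inj_on_image_Pow[OF assms(1)], of \<sigma> K] that by blast
  qed
  have un: "f ` \<tau> \<union> f ` F \<in> (`) f ` K \<longleftrightarrow> \<tau> \<union> F \<in> K" if "\<tau> \<in> K" for \<tau>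
    using mem[of "\<tau> \<union> F"] that assms(2,3) by (metis Sup_le_iff Un_least image_Un)
  have "(`) f ` {\<sigma> \<in> K. \<not> F \<subseteq> \<sigma>} = {\<sigma> \<in> (`) f ` K. \<not> f ` F \<subseteq> \<sigma>}"
    using sub by blast
  moreover have "(`) f ` {insert v \<tau> | \<tau>. \<tau> \<in> K \<and> \<not> F \<subseteq> \<tau> \<and> \<tau> \<union> F \<in> K} =
      {insert (f v) \<tau> | \<tau>. \<tau> \<in> (`) f ` K \<and> \<not> f ` F \<subseteq> \<tau> \<and> \<tau> \<union> f ` F \<in> (`) f ` K}"
    (is "?L = ?R")
  proof (intro equalityI subsetI)
    fix \<rho> assume "\<rho> \<in> ?L"
    then obtain \<tau> where "\<tau> \<in> K" "\<not> F \<subseteq> \<tau>" "\<tau> \<union> F \<in> K" "\<rho> = insert (f v) (f ` \<tau>)" by auto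
    then show "\<rho> \<in> ?R" using sub[of \<tau>] un[of \<tau>] by blast
  next
    fix \<rho> assume "\<rho> \<in> ?R"
    then obtain \<tau> where "\<tau> \<in> K" "\<not> f ` F \<subseteq> f ` \<tau>" "f ` \<tau> \<union> f ` F \<in> (`) f ` K"
      and \<rho>: "\<rho> = insert (f v) (f ` \<tau>)" by blast
    then have "insert v \<tau> \<in> {insert v \<tau> | \<tau>. \<tau> \<in> K \<and> \<not> F \<subseteq> \<tau> \<and> \<tau> \<union> F \<in> K}"
      using sub[of \<tau>] un[of \<tau>] by blast
    then have "f ` insert v \<tau> \<in> ?L" by (rule imageI)
    then show "\<rho> \<in> ?L" by (simp add: \<rho>)
  qed
  ultimately show ?thesis unfolding stellar_subdivision_def image_Un by simp
qed

lemma stellar_step_image: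
  assumes f: "inj_on f W" and step: "stellar_step_within W K L"
  shows "stellar_step ((`) f ` K) ((`) f ` L)"
proof -
  obtain F v where F: "F \<in> K" "F \<noteq> {}" and v: "v \<in> W" "v \<notin> \<Union>K" and W: "\<Union>K \<subseteq> W"
    and L: "L = stellar_subdivision K F v"
    using step unfolding stellar_step_within_def by blast
  have "F \<subseteq> W" using F(1) W by blast
  have "f v \<notin> f ` \<Union>K" using inj_on_image_mem_iff[OF f v(1) W] v(2) by simp
  then have "f v \<notin> \<Union>((`) f ` K)" by (simp add: image_Union)
  moreover have "(`) f ` L = stellar_subdivision ((`) f ` K) (f ` F) (f v)"
    unfolding L by (rule stellar_subdivision_image[OF f W \<open>F \<subseteq> W\<close> v(1)])
  moreover have "f ` F \<in> (`) f ` K" "f ` F \<noteq> {}" using F by blast+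
  ultimately show ?thesis unfolding stellar_step_def by blast
qed

lemma stellar_steps_image:
  assumes f: "inj_on f W" and steps: "(stellar_step_within W)\<^sup>*\<^sup>* K L"
  shows "stellar_step\<^sup>*\<^sup>* ((`) f ` K) ((`) f ` L)"
  using steps
proof (induction rule: rtranclp_induct)
  case (step L L')
  from step.IH stellar_step_image[OF f step.hyps(2)] show ?case by (rule rtranclp.rtrancl_into_rtrancl)
qed simp

lemma complex_iso_images:
  assumes a: "inj_on a (\<Union>K)" and b: "inj_on b (\<Union>K)"
  shows "complex_iso ((`) a ` K) ((`) b ` K)"
  unfolding complex_iso_def
proof (intro exI conjI)
  let ?h = "b \<circ> inv_into (\<Union>K) a"
  have inv: "inv_into (\<Union>K) a (a v) = v" if "v \<in> \<Union>K" for v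
    using inv_into_f_f[OF a that] .
  have V: "\<Union>((`) a ` K) = a ` \<Union>K" by (simp add: image_Union)
  have h: "?h (a v) = b v" if "v \<in> \<Union>K" for v using inv[OF that] by simp
  show "inj_on ?h (\<Union>((`) a ` K))"
    unfolding V
  proof (rule inj_onI)
    fix v w assume vw: "v \<in> a ` \<Union>K" "w \<in> a ` \<Union>K" "?h v = ?h w"
    then obtain v' w' where "v' \<in> \<Union>K" "v = a v'" "w' \<in> \<Union>K" "w = a w'" by blast
    moreover from this vw(3) have "b v' = b w'" using h by metis
    ultimately show "v = w" using inj_onD[OF b] by metis
  qed
  have "?h ` a ` \<sigma> = b ` \<sigma>" if "\<sigma> \<in> K" for \<sigma>
  proof -
    have "(\<lambda>v. ?h (a v)) ` \<sigma> = b ` \<sigma>" by (rule image_cong[OF refl], rule h) (use that in blast)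
    then show ?thesis by (simp only: image_image)
  qed
  then have "(\<lambda>\<sigma>. ?h ` a ` \<sigma>) ` K = (`) b ` K" by (rule image_cong[OF refl])
  then show "(`) ?h ` (`) a ` K = (`) b ` K" by (simp only: image_image)
qed

section \<open>Subdividing the complex of trees\<close>

theorem corollary3p2:
  fixes n :: nat
  assumes "n \<ge> 3"
  shows "obtainable_by_stellar_subdivisions (tree_complex n)
           (order_complex (refines {1..n}) (proper_partitions n))"
proof -
  obtain f :: "nat set set \<Rightarrow> nat" where f: "inj_on f (proper_blocks n)"
    using finite_imp_inj_to_nat_seg[OF finite_proper_blocks] by metis
  let ?single = "\<lambda>S :: nat set. {S}"
  have "2 \<le> n" using assms by simp
  have V: "\<Union>(laminar_complex n) \<subseteq> proper_clusters n" by (auto simp: laminar_complex_def)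
  have "complex_iso (tree_complex n) ((`) f ` nested_complex n {})"
  proof -
    have "inj_on (f \<circ> ?single) (proper_clusters n)"
    proof (rule comp_inj_on)
      show "inj_on f (?single ` proper_clusters n)"
        by (rule inj_on_subset[OF f]) (simp add: proper_blocks_eq)
    qed simp
    then have "complex_iso ((`) (spider_type n) ` laminar_complex n)
        ((`) (f \<circ> ?single) ` laminar_complex n)"
      by (intro complex_iso_images inj_on_subset[OF inj_on_spider_type V] inj_on_subset[OF _ V])
    then show ?thesis
      by (simp add: tree_complex_eq[OF \<open>2 \<le> n\<close>] nested_complex_empty image_image)
  qed
  moreover have "stellar_step\<^sup>*\<^sup>* ((`) f ` nested_complex n {}) ((`) f ` nested_complex n (composites n))"
    by (rule stellar_steps_image[OF f nested_complex_steps]) simp_all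
  moreover have "complex_iso ((`) f ` nested_complex n (composites n))
      (order_complex (refines {1..n}) (proper_partitions n))"
  proof -
    have V: "\<Union>(nested_complex n (composites n)) \<subseteq> proper_blocks n"
      using nested_complex_composites by auto
    have "inj_on (add_singletons n) (proper_blocks n)"
      using bij_betw_add_singletons by (rule bij_betw_imp_inj_on)
    then show ?thesis
      unfolding order_complex_eq
      by (intro complex_iso_images inj_on_subset[OF f V] inj_on_subset[OF _ V])
  qed
  ultimately show ?thesis unfolding obtainable_by_stellar_subdivisions_def by blast
qed

end
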